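(* Let $X$ be a path-connected space, $x_0\in X$, and $H\leq\pi_1(X,x_0)$ a subgroup. (1) If $H$ is $(D,d_\infty)$-closed, then $H$ is $(W,w_\infty)$-closed. (2) If $H$ is $(W,w_\infty)$-closed, then $H$ is $(C,c_\tau)$-closed. (3) If $H$ is normal in $\pi_1(X,x_0)$ and $(W,w_\infty)$-closed, then $H$ is $(P,p_\tau)$-closed.
   Context: A map is a continuous function; $f_{\#}$ denotes the homomorphism induced on fundamental groups. For paths, $\alpha\cdot\beta$ is concatenation and $\alpha^{-}$ the reverse path; restrictions of paths to subintervals are regarded as paths via linear reparametrization. Closed subgroups: for a based space $(\mathbb{T},t_0)$, a subgroup $T\leq\pi_1(\mathbb{T},t_0)$ and $g\in\pi_1(\mathbb{T},t_0)$, a subgroup $H\leq\pi_1(X,x_0)$ is $(T,g)$-closed if for every map $f:(\mathbb{T},t_0)\to(X,x_0)$ with $f_{\#}(T)\leq H$ we have $f_{\#}(g)\in H$. The test space $\mathbb{D}$: for integers $n\geq1$, $1\leq j\leq 2^{n-1}$ let $\mathbb{D}(n,j)=\{(x,y)\in\mathbb{R}^2\mid (x-\frac{2j-1}{2^n})^2+y^2=(\frac1{2^n})^2,\ y\geq0\}$, and let $\mathbb{D}=([0,1]\times\{0\})\cup\bigcup_{n,j}\mathbb{D}(n,j)\subseteq\mathbb{R}^2$ with basepoint $d_0=(0,0)$. Let $\ell_{n,j}(t)=\left(\frac{t+j-1}{2^{n-1}},\frac{1}{2^{n-1}}\sqrt{t-t^2}\right)$, $t\in[0,1]$; the paths $\ell_{n,j}$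 and $\ell_{n,j}^{-}$ are called standard. Let $\lambda_1=\ell_{1,1}$ and $\lambda_\infty(t)=(t,0)$. $D\leq\pi_1(\mathbb{D},d_0)$ is the subgroup of homotopy classes of loops at $d_0$ that are finite concatenations of standard paths, and $d_\infty=[\lambda_1\cdot\lambda_\infty^{-}]$. The test space $\mathbb{W}$: let $\mathcal{C}\subseteq[0,1]$ be the standard middle third Cantor set and $\mathcal{I}$ the set of components of $[0,1]\setminus\mathcal{C}$. For $I=(a,b)\in\mathcal{I}$ let $\mathbb{W}_I\subseteq\mathbb{R}^2$ be the upper half of the circle with diameter $[a,b]\times\{0\}$. Let $\mathbb{W}=([0,1]\times\{0\})\cup\bigcup_{I\in\mathcal{I}}\mathbb{W}_I\subseteq\mathbb{R}^2$ with basepoint $d_0=(0,0)$. Let $\lambda_\infty:[0,1]\to\mathbb{W}$, $\lambda_\infty(t)=(t,0)$, and let $\upsilon_\infty:[0,1]\to\mathbb{W}$ be the arc with $\upsilon_\infty(t)=(t,0)$ for $t\in\mathcal{C}$ and, for $I=(a,b)\in\mathcal{I}$, $\upsilon_\infty|_{[a,b]}$ the arc along $\mathbb{W}_I$ from $(a,0)$ to $(b,0)$. $W\leq\pi_1(\mathbb{W},d_0)$ is generated by $\{[\upsilon_\infty|_{[0,b]}\cdot\lambda_\infty|_{[a,b]}^{-}\cdot\upsilon_\infty|_{[0,a]}^{-}]\mid(a,b)\in\mathcal{I}\}$, and $w_\infty=[\upsilon_\infty\cdot\lambda_\infty^{-}]$. The test space $\mathbb{H}^+$: let $C_n\subseteq\mathbb{R}^2$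 be the circle of radius $\frac1n$ centered at $(\frac1n,0)$, $\mathbb{H}=\bigcup_{n\geq1}C_n$, $b_0=(0,0)$, and $\mathbb{H}^+=\mathbb{H}\cup([-1,0]\times\{0\})$ with basepoint $b_0^+=(-1,0)$. Let $\ell_n$ be the loop based at $b_0$ traversing $C_n$ once counterclockwise and $\iota:[0,1]\to\mathbb{H}^+$, $\iota(t)=(t-1,0)$. Write $[0,1]\setminus\mathcal{C}=\bigcup_{n\geq1}\bigcup_{k=1}^{2^{n-1}}I_n^k$, where $I_n^k$ are the components of length $\frac{1}{3^n}$, indexed by $k$ in their natural order. Let $\ell_\tau:[0,1]\to\mathbb{H}$ be the loop with $\ell_\tau(\mathcal{C})=\{b_0\}$ and equal to $\ell_{2^{n-1}+k-1}$ (linearly reparametrized) on $\overline{I_n^k}$. Put $c_n=[\iota\cdot\ell_n\cdot\iota^{-}]$, $C=\langle c_n\mid n\in\mathbb{N}\rangle\leq\pi_1(\mathbb{H}^+,b_0^+)$, $c_\tau=[\iota\cdot\ell_\tau\cdot\iota^{-}]$. Let $f_{odd},f_{even}:\mathbb{H}\to\mathbb{H}$ be the maps with $f_{odd}\circ\ell_n=\ell_{2n-1}$ and $f_{even}\circ\ell_n=\ell_{2n}$. Put $p_n=[\iota\cdot\ell_{2n-1}\cdot\ell_{2n}^{-}\cdot\iota^{-}]$, $P=\langle p_n\mid n\in\mathbb{N}\rangle\leq\pi_1(\mathbb{H}^+,b_0^+)$, and $p_\tau=[\iota\cdot(f_{odd}\circ\ell_\tau)\cdot(f_{even}\circ\ell_\tau)^{-}\cdot\iota^{-}]$.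 *)

theory Defs
  imports "HOL-Analysis.Analysis" "HOL-Algebra.Generated_Groups" "HOL-Algebra.Coset"
begin

section \<open>The fundamental group of a subset of a topological space\<close>

text \<open>Elements of the fundamental group are genuine equivalence classes for
  \<^const>\<open>homotopic_paths\<close>.  If \<open>p\<close> is not a path in \<open>S\<close>, then \<open>path_class S p\<close> is empty.\<close>

definition path_class :: "'a::topological_space set \<Rightarrow> (real \<Rightarrow> 'a) \<Rightarrow> (real \<Rightarrow> 'a) set" where
  "path_class S p = {q. homotopic_paths S p q}"

definition loops_at :: "'a::topological_space set \<Rightarrow> 'a \<Rightarrow> (real \<Rightarrow> 'a) set" where
  "loops_at S x = {p. path p \<and> path_image p \<subseteq> S \<and> pathstart p = x \<and> pathfinish p = x}"

definition fundamental_group ::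
  "'a::topological_space set \<Rightarrow> 'a \<Rightarrow> (real \<Rightarrow> 'a) set monoid" where
  "fundamental_group S x =
     \<lparr>carrier = path_class S ` loops_at S x,
      mult = (\<lambda>A B. \<Union>p\<in>A. \<Union>q\<in>B. path_class S (p +++ q)),
      one = path_class S (\<lambda>_. x)\<rparr>"

text \<open>The map \<open>f\<^sub>#\<close> for \<open>f\<close> with values in \<open>Y\<close>.\<close>

definition induced_map ::
  "'b::topological_space set \<Rightarrow> ('a::topological_space \<Rightarrow> 'b) \<Rightarrow> (real \<Rightarrow> 'a) set \<Rightarrow> (real \<Rightarrow> 'b) set" where
  "induced_map Y f A = (\<Union>p\<in>A. path_class Y (f \<circ> p))"

text \<open>\<open>H\<close> is \<open>(K, g)\<close>-closed, where \<open>(T, t0)\<close> is the based test space.\<close>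

definition closed_wrt ::
  "'a::topological_space set \<Rightarrow> 'a \<Rightarrow> (real \<Rightarrow> 'a) set set \<Rightarrow> (real \<Rightarrow> 'a) set \<Rightarrow>
   'b::topological_space set \<Rightarrow> 'b \<Rightarrow> (real \<Rightarrow> 'b) set set \<Rightarrow> bool" where
  "closed_wrt T t0 K g X x0 H \<longleftrightarrow>
     (\<forall>f. continuous_on T f \<and> f ` T \<subseteq> X \<and> f t0 = x0 \<and> induced_map X f ` K \<subseteq> H
          \<longrightarrow> induced_map X f g \<in> H)"

lemma path_class_eq: "homotopic_paths S p q \<Longrightarrow> path_class S p = path_class S q"
  unfolding path_class_def by (blast intro: homotopic_paths_trans homotopic_paths_sym)

lemma mult_path_class:
  assumes "p \<in> loops_at S x" "q \<in> loops_at S x"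
  shows "path_class S p \<otimes>\<^bsub>fundamental_group S x\<^esub> path_class S q = path_class S (p +++ q)"
proof -
  have "path_class S (p' +++ q') = path_class S (p +++ q)"
    if "p' \<in> path_class S p" "q' \<in> path_class S q" for p' q'
    using that assms
    by (intro path_class_eq homotopic_paths_sym [OF homotopic_paths_join])
       (auto simp: path_class_def loops_at_def)
  then have "(\<Union>p'\<in>path_class S p. \<Union>q'\<in>path_class S q. path_class S (p' +++ q')) =
      (\<Union>p'\<in>path_class S p. \<Union>q'\<in>path_class S q. path_class S (p +++ q))"
    by (intro SUP_cong refl)
  moreover have "p \<in> path_class S p" "q \<in> path_class S q"
    using assms by (auto simp: path_class_def loops_at_def)
  ultimately show ?thesis
    unfolding fundamental_group_def monoid.simps by blast
qed

lemma induced_map_path_class: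
  assumes "path p" "path_image p \<subseteq> S" "continuous_on S f" "f ` S \<subseteq> Y"
  shows "induced_map Y f (path_class S p) = path_class Y (f \<circ> p)"
proof -
  have "path_class Y (f \<circ> p') = path_class Y (f \<circ> p)" if "p' \<in> path_class S p" for p'
    using that assms
    by (intro path_class_eq homotopic_paths_continuous_image)
       (auto simp: path_class_def homotopic_paths_sym)
  then have "induced_map Y f (path_class S p) = (\<Union>p'\<in>path_class S p. path_class Y (f \<circ> p))"
    unfolding induced_map_def by (intro SUP_cong refl)
  moreover have "p \<in> path_class S p"
    using assms by (auto simp: path_class_def)
  ultimately show ?thesis
    by blast
qed

lemma const_in_loops_at: "x \<in> S \<Longrightarrow> (\<lambda>_. x) \<in> loops_at S x"
  by (auto simp: loops_at_def path_def path_image_def pathstart_def pathfinish_def)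

lemma join_in_loops_at: "p \<in> loops_at S x \<Longrightarrow> q \<in> loops_at S x \<Longrightarrow> p +++ q \<in> loops_at S x"
  by (auto simp: loops_at_def path_image_join)

lemma reversepath_in_loops_at: "p \<in> loops_at S x \<Longrightarrow> reversepath p \<in> loops_at S x"
  by (auto simp: loops_at_def)

lemma const_join_class:
  assumes "p \<in> loops_at S x"
  shows "path_class S ((\<lambda>_. x) +++ p) = path_class S p"
proof (rule path_class_eq, rule homotopic_paths_sym,
       rule homotopic_paths_reparametrize [where f = "\<lambda>t. max 0 (2 * t - 1)"])
  show "path p" "path_image p \<subseteq> S" using assms by (auto simp: loops_at_def)
  show "continuous_on {0..1} (\<lambda>t::real. max 0 (2 * t - 1))"
    by (intro continuous_intros)
  show "((\<lambda>_. x) +++ p) t = p (max 0 (2 * t - 1))" if "t \<in> {0..1}" for t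
  proof -
    have "max 0 (2 * t - 1) = (if t \<le> 1/2 then 0 else 2 * t - 1)"
      by auto
    then show ?thesis
      using assms by (simp add: joinpaths_def loops_at_def pathstart_def)
  qed
qed (auto simp: Pi_def)

lemma reversepath_join_class:
  assumes "p \<in> loops_at S x"
  shows "path_class S (reversepath p +++ p) = path_class S (\<lambda>_. x)"
proof (rule path_class_eq, rule homotopic_paths_sym, unfold homotopic_paths, intro exI conjI)
  let ?h = "\<lambda>(s::real, t::real). p (1 - s * (1 - \<bar>1 - 2 * t\<bar>))"
  have bnd: "1 - s * (1 - \<bar>1 - 2 * t\<bar>) \<in> {0..1}" if "s \<in> {0..1}" "t \<in> {0..1}" for s t :: real
    using that mult_mono [of s 1 "1 - \<bar>1 - 2 * t\<bar>" 1] by auto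
  have p: "continuous_on {0..1} p" "p ` {0..1} \<subseteq> S" "p 0 = x" "p 1 = x"
    using assms by (auto simp: loops_at_def path_def path_image_def pathstart_def pathfinish_def)
  show "continuous_on ({0..1} \<times> {0..1}) ?h"
    unfolding case_prod_beta
  proof (rule continuous_on_compose2 [OF p(1)])
    show "continuous_on ({0..1} \<times> {0..1}) (\<lambda>z::real \<times> real. 1 - fst z * (1 - \<bar>1 - 2 * snd z\<bar>))"
      by (intro continuous_intros)
    show "(\<lambda>z::real \<times> real. 1 - fst z * (1 - \<bar>1 - 2 * snd z\<bar>)) ` ({0..1} \<times> {0..1}) \<subseteq> {0..1}"
      using bnd by (auto simp del: atLeastAtMost_iff)
  qed
  show "?h \<in> {0..1} \<times> {0..1} \<rightarrow> S"
  proof (rule funcsetI, clarify)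
    fix s t :: real
    assume "s \<in> {0..1}" "t \<in> {0..1}"
    with bnd p(2) show "p (1 - s * (1 - \<bar>1 - 2 * t\<bar>)) \<in> S"
      by blast
  qed
  show "\<forall>t\<in>{0..1}. ?h (0, t) = x"
    by (simp add: p)
  show "\<forall>t\<in>{0..1}. ?h (1, t) = (reversepath p +++ p) t"
    by (auto simp: joinpaths_def reversepath_def abs_if)
  show "\<forall>s\<in>{0..1}. pathstart (?h \<circ> Pair s) = pathstart (\<lambda>_. x) \<and>
          pathfinish (?h \<circ> Pair s) = pathfinish (\<lambda>_. x)"
    by (simp add: p pathstart_def pathfinish_def)
qed

lemma group_fundamental_group:
  assumes "x \<in> S"
  shows "group (fundamental_group S x)"
proof (rule groupI)
  let ?G = "fundamental_group S x"
  have carr: "carrier ?G = path_class S ` loops_at S x" and one: "\<one>\<^bsub>?G\<^esub> = path_class S (\<lambda>_. x)"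
    by (simp_all add: fundamental_group_def)
  show "\<one>\<^bsub>?G\<^esub> \<in> carrier ?G"
    using assms by (simp add: carr one const_in_loops_at)
  show "A \<otimes>\<^bsub>?G\<^esub> B \<in> carrier ?G" if "A \<in> carrier ?G" "B \<in> carrier ?G" for A B
    using that by (auto simp: carr mult_path_class join_in_loops_at)
  show "A \<otimes>\<^bsub>?G\<^esub> B \<otimes>\<^bsub>?G\<^esub> C = A \<otimes>\<^bsub>?G\<^esub> (B \<otimes>\<^bsub>?G\<^esub> C)"
    if ABC: "A \<in> carrier ?G" "B \<in> carrier ?G" "C \<in> carrier ?G" for A B C
  proof -
    obtain p q r where pqr: "p \<in> loops_at S x" "q \<in> loops_at S x" "r \<in> loops_at S x"
      and "A = path_class S p" "B = path_class S q" "C = path_class S r"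
      using ABC unfolding carr by blast
    moreover have "path_class S (p +++ (q +++ r)) = path_class S ((p +++ q) +++ r)"
      using pqr by (intro path_class_eq homotopic_paths_assoc) (auto simp: loops_at_def)
    ultimately show ?thesis
      by (simp add: mult_path_class join_in_loops_at)
  qed
  show "\<one>\<^bsub>?G\<^esub> \<otimes>\<^bsub>?G\<^esub> A = A" if "A \<in> carrier ?G" for A
    using that assms by (auto simp: carr one mult_path_class const_in_loops_at const_join_class)
  show "\<exists>B\<in>carrier ?G. B \<otimes>\<^bsub>?G\<^esub> A = \<one>\<^bsub>?G\<^esub>" if "A \<in> carrier ?G" for A
  proof -
    obtain p where "p \<in> loops_at S x" "A = path_class S p"
      using \<open>A \<in> carrier ?G\<close> unfolding carr by blast
    then show ?thesis
      unfolding carr one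
      by (intro bexI [of _ "path_class S (reversepath p)"])
         (auto simp: mult_path_class reversepath_in_loops_at reversepath_join_class)
  qed
qed


section \<open>The test space \<open>\<D>\<close>\<close>

definition D_arc :: "nat \<Rightarrow> nat \<Rightarrow> (real \<times> real) set" where
  "D_arc n j = {(x, y). (x - (2 * real j - 1) / 2 ^ n)\<^sup>2 + y\<^sup>2 = (1 / 2 ^ n)\<^sup>2 \<and> y \<ge> 0}"

definition D_space :: "(real \<times> real) set" where
  "D_space = {0..1} \<times> {0} \<union> (\<Union>n\<in>{1..}. \<Union>j\<in>{1..2 ^ (n - 1)}. D_arc n j)"

definition d0 :: "real \<times> real" where "d0 = (0, 0)"

definition D_path :: "nat \<Rightarrow> nat \<Rightarrow> real \<Rightarrow> real \<times> real" where
  "D_path n j t = ((t + real j - 1) / 2 ^ (n - 1), 1 / 2 ^ (n - 1) * sqrt (t - t\<^sup>2))"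

definition standard_path :: "(real \<Rightarrow> real \<times> real) \<Rightarrow> bool" where
  "standard_path p \<longleftrightarrow>
     (\<exists>n\<ge>1. \<exists>j\<in>{1..2 ^ (n - 1)}. p = D_path n j \<or> p = reversepath (D_path n j))"

inductive standard_concat :: "(real \<Rightarrow> real \<times> real) \<Rightarrow> bool" where
  single: "standard_path p \<Longrightarrow> standard_concat p"
| join: "standard_concat p \<Longrightarrow> standard_concat q \<Longrightarrow> pathfinish p = pathstart q \<Longrightarrow>
         standard_concat (p +++ q)"

definition D_subgroup :: "(real \<Rightarrow> real \<times> real) set set" where
  "D_subgroup =
     {path_class D_space p | p. standard_concat p \<and> pathstart p = d0 \<and> pathfinish p = d0}"

definition lambda_one :: "real \<Rightarrow> real \<times> real" where
  "lambda_one = D_path 1 1"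

definition lambda_inf :: "real \<Rightarrow> real \<times> real" where
  "lambda_inf t = (t, 0)"

definition d_inf :: "(real \<Rightarrow> real \<times> real) set" where
  "d_inf = path_class D_space (lambda_one +++ reversepath lambda_inf)"


section \<open>The Cantor set and its gaps\<close>

fun cantor_stage :: "nat \<Rightarrow> real set" where
  "cantor_stage 0 = {0..1}"
| "cantor_stage (Suc n) = (\<lambda>x. x / 3) ` cantor_stage n \<union> (\<lambda>x. (x + 2) / 3) ` cantor_stage n"

definition cantor_set :: "real set" where
  "cantor_set = (\<Inter>n. cantor_stage n)"

text \<open>A component \<open>(a, b)\<close> of the complement is encoded by the pair of its endpoints.\<close>

definition cantor_gaps :: "(real \<times> real) set" where
  "cantor_gaps = {(a, b). a < b \<and> {a<..<b} \<in> components ({0..1} - cantor_set)}"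

definition gap_of :: "real \<Rightarrow> real \<times> real" where
  "gap_of t = (THE I. I \<in> cantor_gaps \<and> t \<in> {fst I<..<snd I})"


section \<open>The test space \<open>\<W>\<close>\<close>

definition W_arc :: "real \<times> real \<Rightarrow> (real \<times> real) set" where
  "W_arc = (\<lambda>(a, b). {(x, y). (x - (a + b) / 2)\<^sup>2 + y\<^sup>2 = ((b - a) / 2)\<^sup>2 \<and> y \<ge> 0})"

definition W_space :: "(real \<times> real) set" where
  "W_space = {0..1} \<times> {0} \<union> (\<Union>I\<in>cantor_gaps. W_arc I)"

text \<open>Each semicircle is parametrized by its first coordinate; as the endpoints of
  the gaps are fixed, any other choice is homotopic on each gap.\<close>

definition upsilon_inf :: "real \<Rightarrow> real \<times> real" where
  "upsilon_inf t =
     (if t \<in> cantor_set then (t, 0)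
      else let (a, b) = gap_of t in (t, sqrt ((t - a) * (b - t))))"

definition W_generator :: "real \<times> real \<Rightarrow> (real \<Rightarrow> real \<times> real) set" where
  "W_generator = (\<lambda>(a, b). path_class W_space
     (subpath 0 b upsilon_inf +++ reversepath (subpath a b lambda_inf) +++
      reversepath (subpath 0 a upsilon_inf)))"

definition W_subgroup :: "(real \<Rightarrow> real \<times> real) set set" where
  "W_subgroup = generate (fundamental_group W_space d0) (W_generator ` cantor_gaps)"

definition w_inf :: "(real \<Rightarrow> real \<times> real) set" where
  "w_inf = path_class W_space (upsilon_inf +++ reversepath lambda_inf)"


section \<open>The test space \<open>\<H>\<^sup>+\<close>\<close>

definition H_circle :: "nat \<Rightarrow> (real \<times> real) set" where
  "H_circle n = {(x, y). (x - 1 / real n)\<^sup>2 + y\<^sup>2 = (1 / real n)\<^sup>2}"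

definition H_space :: "(real \<times> real) set" where
  "H_space = (\<Union>n\<in>{1..}. H_circle n)"

definition Hplus_space :: "(real \<times> real) set" where
  "Hplus_space = H_space \<union> {-1..0} \<times> {0}"

definition b0 :: "real \<times> real" where "b0 = (0, 0)"

definition b0_plus :: "real \<times> real" where "b0_plus = (-1, 0)"

definition H_loop :: "nat \<Rightarrow> real \<Rightarrow> real \<times> real" where
  "H_loop n t = (1 / real n + 1 / real n * cos (pi + 2 * pi * t),
                 1 / real n * sin (pi + 2 * pi * t))"

definition whisker :: "real \<Rightarrow> real \<times> real" where
  "whisker t = (t - 1, 0)"

text \<open>If \<open>I\<close> is \<open>I\<^sub>n\<^sup>k\<close>, then \<open>gap_level I = n\<close> and \<open>gap_rank I = k\<close>.\<close>

definition gap_level :: "real \<times> real \<Rightarrow> nat" where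
  "gap_level I = (THE n. snd I - fst I = 1 / 3 ^ n)"

definition gap_rank :: "real \<times> real \<Rightarrow> nat" where
  "gap_rank I = card {J \<in> cantor_gaps. gap_level J = gap_level I \<and> fst J \<le> fst I}"

definition l_tau :: "real \<Rightarrow> real \<times> real" where
  "l_tau t =
     (if t \<in> cantor_set then b0
      else let I = gap_of t
           in H_loop (2 ^ (gap_level I - 1) + gap_rank I - 1) ((t - fst I) / (snd I - fst I)))"

definition C_generator :: "nat \<Rightarrow> (real \<Rightarrow> real \<times> real) set" where
  "C_generator n = path_class Hplus_space (whisker +++ H_loop n +++ reversepath whisker)"

definition C_subgroup :: "(real \<Rightarrow> real \<times> real) set set" where
  "C_subgroup = generate (fundamental_group Hplus_space b0_plus) (C_generator ` {1..})"

definition c_tau :: "(real \<Rightarrow> real \<times> real) set" where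
  "c_tau = path_class Hplus_space (whisker +++ l_tau +++ reversepath whisker)"

text \<open>The self-map of \<open>\<H>\<close> determined by \<open>\<ell>\<^sub>n \<mapsto> \<ell>\<^bsub>\<phi>(n)\<^esub>\<close>; see \<open>H_reindex_H_loop\<close> below.\<close>

definition H_reindex :: "(nat \<Rightarrow> nat) \<Rightarrow> real \<times> real \<Rightarrow> real \<times> real" where
  "H_reindex \<phi> p = (THE q. \<exists>n\<ge>1. \<exists>t\<in>{0..1}. p = H_loop n t \<and> q = H_loop (\<phi> n) t)"

lemma H_reindex_H_loop:
  assumes "n \<ge> 1" "t \<in> {0..1}"
  shows "H_reindex \<phi> (H_loop n t) = H_loop (\<phi> n) t"
proof -
  have "H_loop (\<phi> m) s = H_loop (\<phi> n) t"
    if "m \<ge> 1" and eq: "H_loop n t = H_loop m s" for m s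
  proof -
    define c d where "c = 1 + cos (pi + 2 * pi * t)" and "d = sin (pi + 2 * pi * t)"
    define c' d' where "c' = 1 + cos (pi + 2 * pi * s)" and "d' = sin (pi + 2 * pi * s)"
    have loop: "H_loop k t = (c / real k, d / real k)" "H_loop k s = (c' / real k, d' / real k)" for k
      by (simp_all add: H_loop_def c_def d_def c'_def d'_def diff_divide_distrib)
    have "(1 + cos z)\<^sup>2 + (sin z)\<^sup>2 = 2 * (1 + cos z)" for z :: real
      using sin_cos_squared_add [of z] by (simp only: power2_sum) simp
    then have sq: "c\<^sup>2 + d\<^sup>2 = 2 * c" "c'\<^sup>2 + d'\<^sup>2 = 2 * c'"
      unfolding c_def d_def c'_def d'_def by blast+
    have pos: "real n > 0" "real m > 0"
      using assms that by auto
    then have lin: "c' * real n = c * real m" "d' * real n = d * real m"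
      using eq by (simp_all add: loop frac_eq_eq)
    then have "2 * c' * (real n)\<^sup>2 = 2 * c * (real m)\<^sup>2"
      unfolding sq [symmetric] distrib_right by (metis power_mult_distrib)
    then have "c' * real n * real n = c * real m * real m"
      by (simp add: power2_eq_square)
    then have "c * real m * real n = c * real m * real m"
      by (simp only: lin(1))
    then consider "c = 0" | "n = m"
      using pos by auto
    then show ?thesis
    proof cases
      case 1
      with sq(1) lin pos show ?thesis
        by (auto simp: loop)
    next
      case 2
      with lin pos show ?thesis
        by (auto simp: loop)
    qed
  qed
  then show ?thesis
    unfolding H_reindex_def using assms by (intro the_equality) blast+
qed

definition f_odd :: "real \<times> real \<Rightarrow> real \<times> real" where
  "f_odd = H_reindex (\<lambda>n. 2 * n - 1)"

definition f_even :: "real \<times> real \<Rightarrow> real \<times> real" where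
  "f_even = H_reindex (\<lambda>n. 2 * n)"

definition P_generator :: "nat \<Rightarrow> (real \<Rightarrow> real \<times> real) set" where
  "P_generator n = path_class Hplus_space
     (whisker +++ H_loop (2 * n - 1) +++ reversepath (H_loop (2 * n)) +++ reversepath whisker)"

definition P_subgroup :: "(real \<Rightarrow> real \<times> real) set set" where
  "P_subgroup = generate (fundamental_group Hplus_space b0_plus) (P_generator ` {1..})"

definition p_tau :: "(real \<Rightarrow> real \<times> real) set" where
  "p_tau = path_class Hplus_space
     (whisker +++ (f_odd \<circ> l_tau) +++ reversepath (f_even \<circ> l_tau) +++ reversepath whisker)"

end

theory Submission
  imports Defs
begin

text \<open>
  Write \<open>p \<doteq> q\<close> for two paths from \<open>x0\<close> with the same end such that \<open>[p \<cdot> q\<^sup>-] \<in> H\<close>. A map from \<open>\<W>\<close>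
  to \<open>X\<close> is a pair of paths \<open>\<alpha>\<close> (along \<open>upsilon_inf\<close>) and \<open>\<beta>\<close> (along the line) that agree on the
  Cantor set, and \<open>(W, w_inf)\<close>-closedness says the following: if \<open>\<alpha>\<close> on \<open>[0, b]\<close> is equivalent to
  \<open>\<alpha>\<close> on \<open>[0, a]\<close> followed by \<open>\<beta>\<close> on \<open>[a, b]\<close>, for every gap \<open>(a, b)\<close>, then \<open>\<alpha> \<doteq> \<beta>\<close>
  (\<open>W_closed_coset_eq\<close>). As the Cantor set is self-similar, a path \<open>c\<close> can be inserted in front of
  \<open>\<alpha>\<close> and \<open>\<beta>\<close> (\<open>W_closed_coset_eq_join\<close>); below, \<open>c\<close> is the image of the whisker of \<open>\<H>\<^sup>+\<close>.

  The element \<open>c_tau\<close> is dealt with by taking \<open>\<alpha>\<close> constant and \<open>\<beta>\<close> the image of \<open>l_tau\<close>. The prefix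
  on \<open>[0, a]\<close> is then trivial, and the hypothesis for a gap is that one generator of \<open>C_subgroup\<close>
  is mapped into \<open>H\<close> (\<open>c_tau_in_H\<close>). For \<open>p_tau\<close>, the paths are the images of \<open>f_odd \<circ> l_tau\<close> and
  \<open>f_even \<circ> l_tau\<close>. Now the prefix is not trivial, and the hypothesis for a gap concerns a conjugate
  of a generator of \<open>P_subgroup\<close>, which lies in \<open>H\<close> when \<open>H\<close> is normal (\<open>p_tau_in_H\<close>).

  To get from \<open>\<D>\<close> to \<open>\<W>\<close>, there is a map \<open>D_to_W\<close> that preserves first coordinates, fixes the line, and
  sends the semicircle over a dyadic interval to the arc that takes exactly those
  semicircles of \<open>\<W>\<close> whose gap is contained in the interval. It never increases heights, which gives
  continuity (\<open>continuous_on_D_to_W\<close>), and it sends \<open>lambda_one\<close> to \<open>upsilon_inf\<close>. Let \<open>\<Lambda> u\<close> be the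
  path to the point \<open>(u, 0)\<close> over the semicircles of all gaps in \<open>[0, u]\<close>. If a standard path leads from
  \<open>u\<close> to \<open>v\<close>, with \<open>u \<le> v\<close>, then \<open>\<Lambda> u\<close> followed by its image differs from \<open>\<Lambda> v\<close> at most over the gap
  that contains \<open>u\<close>, and there by a generator of \<open>W_subgroup\<close>. Hence the two paths are equivalent
  (\<open>\<Lambda>_extend\<close>), and so, by induction, are those for any concatenation of standard paths
  (\<open>standard_concat_coset\<close>). For loops this puts the image of \<open>D_subgroup\<close> into \<open>H\<close>.
\<close>

section \<open>Homotopies of paths in arbitrary spaces\<close>

definition path_in :: "'a::topological_space set \<Rightarrow> (real \<Rightarrow> 'a) \<Rightarrow> bool" where
  "path_in X p \<longleftrightarrow> path p \<and> path_image p \<subseteq> X"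

text \<open>The restriction of a path, written as a composition with a path in the interval, so that
  homotopies in the interval can be pushed forward along \<open>p\<close>; for \<open>v < u\<close> it runs backwards.\<close>

definition seg :: "(real \<Rightarrow> 'a::topological_space) \<Rightarrow> real \<Rightarrow> real \<Rightarrow> real \<Rightarrow> 'a" where
  "seg p u v = p \<circ> linepath u v"

lemma path_in_iff: "path_in X p \<longleftrightarrow> continuous_on {0..1} p \<and> (\<forall>t\<in>{0..1}. p t \<in> X)"
  by (auto simp: path_in_def path_def path_image_def)

lemma homotopic_paths_imp_path_in:
  assumes "homotopic_paths X p q"
  shows "path_in X p" "path_in X q"
  using homotopic_paths_imp_path [OF assms] homotopic_paths_imp_subset [OF assms]
  by (simp_all add: path_in_def)

lemma path_in_join [simp]:
  "pathfinish p = pathstart q \<Longrightarrow> path_in X (p +++ q) \<longleftrightarrow> path_in X p \<and> path_in X q"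
  by (auto simp: path_in_def path_image_join)

lemma path_in_reversepath [simp]: "path_in X (reversepath p) \<longleftrightarrow> path_in X p"
  by (simp add: path_in_def)

lemma path_in_const [simp]: "path_in X (\<lambda>_. x) \<longleftrightarrow> x \<in> X"
  by (auto simp: path_in_iff)

lemma pathstart_const [simp]: "pathstart (\<lambda>_. x) = x"
  and pathfinish_const [simp]: "pathfinish (\<lambda>_. x) = x"
  by (simp_all add: pathstart_def pathfinish_def)

lemma pathstart_seg [simp]: "pathstart (seg p u v) = p u"
  and pathfinish_seg [simp]: "pathfinish (seg p u v) = p v"
  by (simp_all add: seg_def pathstart_def pathfinish_def linepath_def)

lemma reversepath_seg [simp]: "reversepath (seg p u v) = seg p v u"
  by (simp add: seg_def reversepath_def linepath_def fun_eq_iff add.commute)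

lemma seg_0_1 [simp]: "seg p 0 1 = p"
  by (simp add: seg_def linepath_def fun_eq_iff)

lemma seg_1_0 [simp]: "seg p 1 0 = reversepath p"
  using reversepath_seg [of p 0 1] by simp

lemma seg_same [simp]: "seg p u u = (\<lambda>_. p u)"
  by (simp add: seg_def linepath_def fun_eq_iff flip: distrib_right)

lemma subpath_eq_seg: "subpath u v p = seg p u v"
  by (simp add: seg_def subpath_def linepath_def fun_eq_iff algebra_simps)

lemma compose_seg: "f \<circ> seg p u v = seg (f \<circ> p) u v"
  by (simp add: seg_def comp_assoc)

lemma compose_reversepath: "f \<circ> reversepath p = reversepath (f \<circ> p)"
  by (simp add: reversepath_def fun_eq_iff)

lemma linepath_in_01: "u \<in> {0..1} \<Longrightarrow> v \<in> {0..1} \<Longrightarrow> path_in {0..1::real} (linepath u v)"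
  unfolding path_in_def
  by (simp, metis atLeastAtMost_iff closed_segment_subset convex_real_interval(5))

lemma path_in_compose:
  assumes "path_in X p" "path_in {0..1} g"
  shows "path_in X (p \<circ> g)"
  using assms by (auto simp: path_in_iff o_def intro!: continuous_on_compose2 [of "{0..1}" p "{0..1}" g])

lemma path_in_continuous_image:
  assumes "path_in T p" "continuous_on T f" "f ` T \<subseteq> X"
  shows "path_in X (f \<circ> p)"
  using assms by (auto simp: path_in_iff o_def intro!: continuous_on_compose2 [of T f "{0..1}" p])

lemma path_in_seg [simp]:
  "path_in X p \<Longrightarrow> u \<in> {0..1} \<Longrightarrow> v \<in> {0..1} \<Longrightarrow> path_in X (seg p u v)"
  unfolding seg_def by (intro path_in_compose linepath_in_01)

text \<open>The interval is convex, so two paths in it with the same ends are homotopic, and \<open>p\<close> carries the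
  homotopy to \<open>X\<close>. The unit and inverse laws for paths in an arbitrary space follow, as both sides
  are always of the form \<open>p \<circ> g\<close>.\<close>

lemma homotopic_paths_reparam:
  fixes g h :: "real \<Rightarrow> real"
  assumes p: "path_in X p" and gh: "path_in {0..1} g" "path_in {0..1} h"
    and ends: "pathstart g = pathstart h" "pathfinish g = pathfinish h"
  shows "homotopic_paths X (p \<circ> g) (p \<circ> h)"
proof (rule homotopic_paths_continuous_image)
  show "homotopic_paths {0..1} g h"
  proof (rule homotopic_paths_linear)
    show "closed_segment (g t) (h t) \<subseteq> {0..1}" if "t \<in> {0..1}" for t
      using that gh by (intro closed_segment_subset) (auto simp: path_in_iff)
  qed (use gh ends in \<open>auto simp: path_in_def\<close>)
  show "continuous_on {0..1} p" "p \<in> {0..1} \<rightarrow> X"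
    using p by (auto simp: path_in_iff)
qed

lemma homotopic_paths_eqI:
  assumes "path_in X p" "\<And>t. t \<in> {0..1} \<Longrightarrow> p t = q t"
  shows "homotopic_paths X p q"
  using assms by (intro homotopic_paths_eq) (auto simp: path_in_def)

lemma homotopic_paths_seg_join:
  assumes "path_in X p" "u \<in> {0..1}" "v \<in> {0..1}" "w \<in> {0..1}"
  shows "homotopic_paths X (seg p u v +++ seg p v w) (seg p u w)"
proof -
  have "homotopic_paths X (p \<circ> (linepath u v +++ linepath v w)) (p \<circ> linepath u w)"
    using assms by (intro homotopic_paths_reparam) (simp_all add: linepath_in_01)
  then show ?thesis
    by (simp add: seg_def path_compose_join)
qed

lemma homotopic_paths_cancel_right:
  assumes "path_in X p"
  shows "homotopic_paths X (p +++ reversepath p) (\<lambda>_. pathstart p)"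
  using homotopic_paths_seg_join [OF assms, of 0 1 0] by (simp add: pathstart_def)

lemma homotopic_paths_const_join:
  assumes "path_in X p" "pathstart p = x"
  shows "homotopic_paths X ((\<lambda>_. x) +++ p) p"
  using homotopic_paths_seg_join [OF assms(1), of 0 0 1] assms(2) by (simp add: pathstart_def)

lemma homotopic_paths_join_const:
  assumes "path_in X p" "pathfinish p = x"
  shows "homotopic_paths X (p +++ (\<lambda>_. x)) p"
  using homotopic_paths_seg_join [OF assms(1), of 0 1 1] assms(2) by (simp add: pathfinish_def)

lemma homotopic_paths_assoc':
  assumes "path_in X p" "path_in X q" "path_in X r" "pathfinish p = pathstart q" "pathfinish q = pathstart r"
  shows "homotopic_paths X ((p +++ q) +++ r) (p +++ (q +++ r))"
  using assms by (intro homotopic_paths_sym [OF homotopic_paths_assoc]) (auto simp: path_in_def)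

lemma homotopic_paths_join_left:
  assumes "homotopic_paths X p q" "path_in X r" "pathfinish p = pathstart r"
  shows "homotopic_paths X (p +++ r) (q +++ r)"
  using assms by (intro homotopic_paths_join) (auto simp: path_in_def)

lemma homotopic_paths_join_right:
  assumes "homotopic_paths X p q" "path_in X r" "pathfinish r = pathstart p"
  shows "homotopic_paths X (r +++ p) (r +++ q)"
  using assms by (intro homotopic_paths_join) (auto simp: path_in_def)

lemma homotopic_paths_cancel_middle:
  assumes p: "path_in X p" and q: "path_in X q" and r: "path_in X r"
    and ends: "pathfinish p = pathstart q" "pathstart q = pathstart r"
  shows "homotopic_paths X ((p +++ q) +++ (reversepath q +++ r)) (p +++ r)"
proof -
  have "homotopic_paths X ((p +++ q) +++ (reversepath q +++ r)) (p +++ (q +++ (reversepath q +++ r)))"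
    using assms by (intro homotopic_paths_assoc') auto
  moreover have "homotopic_paths X (p +++ (q +++ (reversepath q +++ r))) (p +++ r)"
  proof (rule homotopic_paths_join_right)
    have "homotopic_paths X (q +++ (reversepath q +++ r)) ((q +++ reversepath q) +++ r)"
      using assms by (intro homotopic_paths_sym [OF homotopic_paths_assoc']) auto
    also have "homotopic_paths X ((q +++ reversepath q) +++ r) ((\<lambda>_. pathstart q) +++ r)"
      using assms by (intro homotopic_paths_join_left homotopic_paths_cancel_right) auto
    also have "homotopic_paths X ((\<lambda>_. pathstart q) +++ r) r"
      using assms by (intro homotopic_paths_const_join) auto
    finally show "homotopic_paths X (q +++ (reversepath q +++ r)) r" .
  qed (use assms in auto)
  ultimately show ?thesis
    by (rule homotopic_paths_trans)
qed

lemma loops_at_iff: "p \<in> loops_at X x \<longleftrightarrow> path_in X p \<and> pathstart p = x \<and> pathfinish p = x"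
  by (auto simp: loops_at_def path_in_def)

lemma inv_path_class:
  assumes "x \<in> X" "p \<in> loops_at X x"
  shows "inv\<^bsub>fundamental_group X x\<^esub> (path_class X p) = path_class X (reversepath p)"
proof -
  interpret group "fundamental_group X x"
    by (rule group_fundamental_group) fact
  show ?thesis
  proof (rule inv_equality)
    show "path_class X (reversepath p) \<otimes>\<^bsub>fundamental_group X x\<^esub> path_class X p = \<one>\<^bsub>fundamental_group X x\<^esub>"
      using assms by (simp add: mult_path_class reversepath_in_loops_at reversepath_join_class)
         (simp add: fundamental_group_def)
  qed (use assms reversepath_in_loops_at in \<open>auto simp: fundamental_group_def\<close>)
qed

section \<open>Right cosets of paths\<close>

locale pi1_subgroup =
  fixes X :: "'a::topological_space set" and x0 :: 'a and H :: "(real \<Rightarrow> 'a) set set"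
  assumes base: "x0 \<in> X" and H: "subgroup H (fundamental_group X x0)"
begin

interpretation group "fundamental_group X x0"
  using base by (rule group_fundamental_group)

text \<open>Two paths from \<open>x0\<close> with the same end are equivalent when they differ by an element of \<open>H\<close> on
  the left. The relation is compatible with appending paths on the right, while putting a loop
  in front of both paths needs \<open>H\<close> to be normal.\<close>

definition coset_eq :: "(real \<Rightarrow> 'a) \<Rightarrow> (real \<Rightarrow> 'a) \<Rightarrow> bool" (infix "\<doteq>" 50) where
  "p \<doteq> q \<longleftrightarrow> path_in X p \<and> path_in X q \<and> pathstart p = x0 \<and> pathstart q = x0 \<and>
     pathfinish p = pathfinish q \<and> path_class X (p +++ reversepath q) \<in> H"

lemma coset_eqD:
  assumes "p \<doteq> q"
  shows "path_in X p" "path_in X q" "pathstart p = x0" "pathstart q = x0"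
    "pathfinish p = pathfinish q" "path_class X (p +++ reversepath q) \<in> H"
  using assms by (auto simp: coset_eq_def)

lemma path_class_homotopic_in_H:
  "homotopic_paths X p q \<Longrightarrow> path_class X p \<in> H \<longleftrightarrow> path_class X q \<in> H"
  by (metis path_class_eq)

lemma const_class_in_H: "path_class X (\<lambda>_. x0) \<in> H"
  using subgroup.one_closed [OF H] by (simp add: fundamental_group_def)

lemma coset_eq_homotopic:
  assumes "homotopic_paths X p q" "pathstart p = x0"
  shows "p \<doteq> q"
proof -
  have pq: "path_in X p" "path_in X q" "pathstart q = x0" "pathfinish p = pathfinish q"
    using homotopic_paths_imp_path_in [OF assms(1)] homotopic_paths_imp_pathstart [OF assms(1)]
      homotopic_paths_imp_pathfinish [OF assms(1)] assms(2) by simp_all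
  then have "homotopic_paths X (p +++ reversepath q) (q +++ reversepath q)"
    using assms by (intro homotopic_paths_join_left) auto
  moreover have "homotopic_paths X (q +++ reversepath q) (\<lambda>_. x0)"
    using homotopic_paths_cancel_right [of X q] pq by simp
  ultimately have "path_class X (p +++ reversepath q) \<in> H"
    using const_class_in_H by (simp add: path_class_homotopic_in_H)
  with pq assms show ?thesis
    by (simp add: coset_eq_def)
qed

lemma coset_eq_refl: "path_in X p \<Longrightarrow> pathstart p = x0 \<Longrightarrow> p \<doteq> p"
  by (rule coset_eq_homotopic) (auto simp: path_in_def)

lemma coset_eq_sym:
  assumes "p \<doteq> q"
  shows "q \<doteq> p"
proof -
  note pq = coset_eqD [OF assms]
  have "p +++ reversepath q \<in> loops_at X x0"
    using pq by (simp add: loops_at_iff)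
  then have "path_class X (reversepath (p +++ reversepath q)) \<in> H"
    using subgroup.m_inv_closed [OF H pq(6)] base by (simp add: inv_path_class)
  then show ?thesis
    using pq by (simp add: coset_eq_def reversepath_joinpaths)
qed

lemma coset_eq_trans [trans]:
  assumes "p \<doteq> q" "q \<doteq> r"
  shows "p \<doteq> r"
proof -
  note pq = coset_eqD [OF assms(1)] and qr = coset_eqD [OF assms(2)]
  have "path_class X ((p +++ reversepath q) +++ (q +++ reversepath r)) \<in> H"
    using subgroup.m_closed [OF H pq(6) qr(6)] pq qr
    by (simp add: mult_path_class loops_at_iff)
  moreover have "homotopic_paths X ((p +++ reversepath q) +++ (q +++ reversepath r)) (p +++ reversepath r)"
    using homotopic_paths_cancel_middle [of X p "reversepath q" "reversepath r"] pq qr by simp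
  ultimately show ?thesis
    using pq qr path_class_homotopic_in_H by (auto simp: coset_eq_def)
qed

lemma coset_eq_join:
  assumes "p \<doteq> q" "path_in X r" "pathfinish p = pathstart r"
  shows "p +++ r \<doteq> q +++ r"
proof -
  note pq = coset_eqD [OF assms(1)]
  have "homotopic_paths X ((p +++ r) +++ (reversepath r +++ reversepath q)) (p +++ reversepath q)"
    using pq assms by (intro homotopic_paths_cancel_middle) auto
  then have "path_class X ((p +++ r) +++ reversepath (q +++ r)) \<in> H"
    using pq assms by (simp add: reversepath_joinpaths path_class_homotopic_in_H)
  then show ?thesis
    using pq assms by (simp add: coset_eq_def)
qed

lemma coset_eq_const_iff:
  assumes "p \<in> loops_at X x0"
  shows "p \<doteq> (\<lambda>_. x0) \<longleftrightarrow> path_class X p \<in> H"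
proof -
  have "homotopic_paths X (p +++ (\<lambda>_. x0)) p"
    using assms by (intro homotopic_paths_join_const) (auto simp: loops_at_iff)
  moreover have "reversepath (\<lambda>_. x0) = (\<lambda>_. x0)"
    by (simp add: reversepath_def)
  ultimately show ?thesis
    using assms base path_class_homotopic_in_H by (auto simp: coset_eq_def loops_at_iff)
qed

lemma coset_eq_iff_three:
  assumes "path_in X c" "path_in X p" "path_in X q" "pathstart c = x0"
    "pathfinish c = pathstart p" "pathfinish p = pathfinish q" "pathfinish c = pathstart q"
  shows "c +++ p \<doteq> c +++ q \<longleftrightarrow>
    path_class X (c +++ (p +++ (reversepath q +++ reversepath c))) \<in> H"
proof -
  have "homotopic_paths X ((c +++ p) +++ (reversepath q +++ reversepath c)) (c +++ (p +++ (reversepath q +++ reversepath c)))"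
    using assms by (intro homotopic_paths_assoc') auto
  then show ?thesis
    using assms path_class_homotopic_in_H by (simp add: coset_eq_def reversepath_joinpaths)
qed

lemma coset_eq_normal_join:
  assumes "H \<lhd> fundamental_group X x0" "p \<doteq> q" "l \<in> loops_at X x0"
  shows "l +++ p \<doteq> l +++ q"
proof -
  note pq = coset_eqD [OF assms(2)]
  let ?r = "p +++ reversepath q"
  have l: "path_in X l" "pathstart l = x0" "pathfinish l = x0"
    using assms by (auto simp: loops_at_iff)
  have lc: "path_class X l \<in> carrier (fundamental_group X x0)"
    using assms by (simp add: fundamental_group_def)
  have r: "?r \<in> loops_at X x0"
    using pq by (simp add: loops_at_iff)
  have "path_class X l \<otimes>\<^bsub>fundamental_group X x0\<^esub> path_class X ?r
      \<otimes>\<^bsub>fundamental_group X x0\<^esub> inv\<^bsub>fundamental_group X x0\<^esub> path_class X l \<in> H"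
    by (rule normal.inv_op_closed2 [OF assms(1) lc pq(6)])
  then have *: "path_class X ((l +++ ?r) +++ reversepath l) \<in> H"
    using assms r base by (simp add: inv_path_class mult_path_class join_in_loops_at reversepath_in_loops_at)
  have "homotopic_paths X ((l +++ ?r) +++ reversepath l) (((l +++ p) +++ reversepath q) +++ reversepath l)"
    using pq l by (intro homotopic_paths_join_left homotopic_paths_sym [OF homotopic_paths_assoc']) auto
  moreover have "homotopic_paths X (((l +++ p) +++ reversepath q) +++ reversepath l)
       ((l +++ p) +++ (reversepath q +++ reversepath l))"
    using pq l by (intro homotopic_paths_assoc') auto
  ultimately have "path_class X ((l +++ p) +++ reversepath (l +++ q)) \<in> H"
    using * pq l path_class_homotopic_in_H by (simp add: reversepath_joinpaths)
  then show ?thesis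
    using pq l by (simp add: coset_eq_def)
qed

text \<open>Since \<open>f\<close> induces a homomorphism, it suffices to know where the generators go. The induction
  carries a representing loop, because \<open>induced_map\<close> acts on sets of loops.\<close>

lemma induced_generate_subset:
  assumes f: "continuous_on T f" "f ` T \<subseteq> X" "f t0 = x0" and t0: "t0 \<in> T"
    and A: "A \<subseteq> path_class T ` loops_at T t0" "induced_map X f ` A \<subseteq> H"
  shows "induced_map X f ` generate (fundamental_group T t0) A \<subseteq> H"
proof -
  have loop: "f \<circ> p \<in> loops_at X x0" if "p \<in> loops_at T t0" for p
    using that f path_in_continuous_image [of T p f X]
    by (auto simp: loops_at_iff pathstart_def pathfinish_def)
  have ind: "induced_map X f (path_class T p) = path_class X (f \<circ> p)" if "p \<in> loops_at T t0" for p
    using that f by (intro induced_map_path_class) (auto simp: loops_at_def)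
  have "\<exists>p\<in>loops_at T t0. g = path_class T p \<and> path_class X (f \<circ> p) \<in> H"
    if "g \<in> generate (fundamental_group T t0) A" for g
    using that
  proof induction
    case one
    have "path_class X (f \<circ> (\<lambda>_. t0)) \<in> H"
      using const_class_in_H f by (simp add: o_def)
    then show ?case
      using t0 by (intro bexI [of _ "\<lambda>_. t0"]) (auto simp: fundamental_group_def const_in_loops_at)
  next
    case (incl h)
    then obtain p where p: "p \<in> loops_at T t0" "h = path_class T p"
      using A by auto
    with incl A(2) have "path_class X (f \<circ> p) \<in> H"
      by (metis ind image_subset_iff)
    then show ?case
      using p by blast
  next
    case (inv h)
    then obtain p where p: "p \<in> loops_at T t0" "h = path_class T p"
      using A by auto
    with inv A(2) have "path_class X (f \<circ> p) \<in> H"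
      by (metis ind image_subset_iff)
    from subgroup.m_inv_closed [OF H this] have "path_class X (f \<circ> reversepath p) \<in> H"
      using p base by (simp add: inv_path_class loop compose_reversepath)
    then show ?case
      using p t0 inv_path_class reversepath_in_loops_at by blast
  next
    case (eng h1 h2)
    then obtain p q where pq: "p \<in> loops_at T t0" "q \<in> loops_at T t0"
        "h1 = path_class T p" "h2 = path_class T q"
        "path_class X (f \<circ> p) \<in> H" "path_class X (f \<circ> q) \<in> H"
      by blast
    from subgroup.m_closed [OF H pq(5,6)] have "path_class X (f \<circ> (p +++ q)) \<in> H"
      using pq by (simp add: mult_path_class loop path_compose_join)
    then show ?case
      using pq mult_path_class join_in_loops_at by blast
  qed
  then show ?thesis
    using ind by (fastforce simp del: o_apply)
qed

end

section \<open>The Cantor set and its gaps\<close>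

lemma cantor_stage_subset: "cantor_stage n \<subseteq> {0..1}"
  by (induction n) auto

lemma closed_cantor_stage: "closed (cantor_stage n)"
proof (induction n)
  case (Suc n)
  then have "compact (cantor_stage n)"
    using cantor_stage_subset bounded_subset [OF bounded_closed_interval] compact_eq_bounded_closed by blast
  then have "compact (cantor_stage (Suc n))"
    unfolding cantor_stage.simps
    by (intro compact_Un compact_continuous_image continuous_intros) auto
  then show ?case
    by (rule compact_imp_closed)
qed simp

lemma closed_cantor_set: "closed cantor_set"
  unfolding cantor_set_def using closed_cantor_stage by blast

lemma cantor_set_subset: "cantor_set \<subseteq> {0..1}"
  unfolding cantor_set_def using cantor_stage.simps(1) by blast

lemma cantor_stage_Suc_iff:
  "x \<in> cantor_stage (Suc n) \<longleftrightarrow> 3 * x \<in> cantor_stage n \<or> 3 * x - 2 \<in> cantor_stage n"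
proof -
  have "x = y / 3 \<longleftrightarrow> y = 3 * x" "x = (y + 2) / 3 \<longleftrightarrow> y = 3 * x - 2" for y
    by (auto simp: field_simps)
  then have "x \<in> (\<lambda>x. x / 3) ` cantor_stage n \<longleftrightarrow> 3 * x \<in> cantor_stage n"
    "x \<in> (\<lambda>x. (x + 2) / 3) ` cantor_stage n \<longleftrightarrow> 3 * x - 2 \<in> cantor_stage n"
    by (simp_all add: image_iff)
  then show ?thesis
    by simp
qed

lemma cantor_set_iff_Suc: "x \<in> cantor_set \<longleftrightarrow> (\<forall>n. x \<in> cantor_stage (Suc n))"
proof
  assume *: "\<forall>n. x \<in> cantor_stage (Suc n)"
  have "x \<in> cantor_stage n" for n
  proof (cases n)
    case 0
    with * cantor_stage_subset show ?thesis
      by fastforce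
  qed (use * in simp)
  then show "x \<in> cantor_set"
    by (simp add: cantor_set_def)
qed (unfold cantor_set_def, blast)

text \<open>The two lemmas below are the self-similarity of the Cantor set; they hold since one of the two
  affine images of \<open>x\<close> leaves the interval.\<close>

lemma cantor_set_left_third:
  assumes "x \<le> 1/3"
  shows "x \<in> cantor_set \<longleftrightarrow> 3 * x \<in> cantor_set"
proof -
  have "3 * x - 2 \<notin> cantor_stage n" for n
    using assms cantor_stage_subset by fastforce
  then show ?thesis
    unfolding cantor_set_iff_Suc [of x] cantor_stage_Suc_iff by (simp add: cantor_set_def)
qed

lemma cantor_set_right_third:
  assumes "2/3 \<le> x"
  shows "x \<in> cantor_set \<longleftrightarrow> 3 * x - 2 \<in> cantor_set"
proof -
  have "3 * x \<notin> cantor_stage n" for n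
    using assms cantor_stage_subset by fastforce
  then show ?thesis
    unfolding cantor_set_iff_Suc [of x] cantor_stage_Suc_iff by (simp add: cantor_set_def)
qed

lemma cantor_set_middle_third:
  assumes "1/3 < x" "x < 2/3"
  shows "x \<notin> cantor_set"
proof
  assume "x \<in> cantor_set"
  then have "x \<in> cantor_stage (Suc 0)"
    unfolding cantor_set_def by blast
  then show False
    using assms unfolding cantor_stage_Suc_iff by simp
qed

lemma zero_in_cantor_set: "0 \<in> cantor_set"
proof -
  have "0 \<in> cantor_stage n" for n
    by (induction n) (simp_all add: cantor_stage_Suc_iff del: cantor_stage.simps(2))
  then show ?thesis
    by (simp add: cantor_set_def)
qed

lemma one_in_cantor_set: "1 \<in> cantor_set"
proof -
  have "1 \<in> cantor_stage n" for n
    by (induction n) (simp_all add: cantor_stage_Suc_iff del: cantor_stage.simps(2))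
  then show ?thesis
    by (simp add: cantor_set_def)
qed

lemma third_in_cantor_set: "1/3 \<in> cantor_set"
  and two_thirds_in_cantor_set: "2/3 \<in> cantor_set"
  using cantor_set_left_third [of "1/3"] cantor_set_right_third [of "2/3"]
    zero_in_cantor_set one_in_cantor_set by auto

text \<open>A component that missed one of its endpoints could be enlarged by it; conversely an interval
  cannot extend beyond a point of the Cantor set.\<close>

lemma cantor_gap_iff:
  "(a, b) \<in> cantor_gaps \<longleftrightarrow> a < b \<and> a \<in> cantor_set \<and> b \<in> cantor_set \<and> {a<..<b} \<inter> cantor_set = {}"
proof
  assume "(a, b) \<in> cantor_gaps"
  then have ab: "a < b" and comp: "{a<..<b} \<in> components ({0..1} - cantor_set)"
    by (auto simp: cantor_gaps_def)
  then have sub: "{a<..<b} \<subseteq> {0..1} - cantor_set"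
    by (rule_tac in_components_subset)
  then have "closure {a<..<b} \<subseteq> {0..1}"
    by (intro closure_minimal) auto
  then have 01: "0 \<le> a" "b \<le> 1"
    using ab by auto
  have maximal: "T \<subseteq> {a<..<b}" if "connected T" "T \<subseteq> {0..1} - cantor_set" "(a + b) / 2 \<in> T" for T
  proof -
    have "(a + b) / 2 \<in> {a<..<b} \<inter> T"
      using ab that(3) by simp
    then show ?thesis
      using components_maximal [OF comp that(1,2)] by blast
  qed
  have "a \<in> cantor_set"
  proof (rule ccontr)
    assume "a \<notin> cantor_set"
    then have "{a..<b} \<subseteq> {a<..<b}"
      using sub ab 01 by (intro maximal) (auto simp: subset_iff order_le_less)
    with ab show False by auto
  qed
  moreover have "b \<in> cantor_set"
  proof (rule ccontr)
    assume "b \<notin> cantor_set"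
    then have "{a<..b} \<subseteq> {a<..<b}"
      using sub ab 01 by (intro maximal) (auto simp: subset_iff order_le_less)
    with ab show False by auto
  qed
  ultimately show "a < b \<and> a \<in> cantor_set \<and> b \<in> cantor_set \<and> {a<..<b} \<inter> cantor_set = {}"
    using ab sub by blast
next
  assume asm: "a < b \<and> a \<in> cantor_set \<and> b \<in> cantor_set \<and> {a<..<b} \<inter> cantor_set = {}"
  then have "{a<..<b} \<subseteq> {0..1} - cantor_set"
    using cantor_set_subset by fastforce
  moreover have "T = {a<..<b}"
    if T: "{a<..<b} \<subseteq> T" "T \<subseteq> {0..1} - cantor_set" "connected T" for T
  proof -
    have mid: "(a + b) / 2 \<in> T"
      using T(1) asm by auto
    have "a < x \<and> x < b" if "x \<in> T" for x
    proof (rule ccontr)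
      assume "\<not> (a < x \<and> x < b)"
      then have "a \<in> T \<or> b \<in> T"
        using connectedD_interval [OF T(3) that mid, of a] connectedD_interval [OF T(3) mid that, of b] asm
        by fastforce
      then show False
        using T(2) asm by blast
    qed
    then show ?thesis
      using T(1) by auto
  qed
  ultimately show "(a, b) \<in> cantor_gaps"
    using asm by (simp add: cantor_gaps_def in_components_maximal)
qed

lemma cantor_gapD:
  assumes "I \<in> cantor_gaps"
  shows "fst I < snd I" "fst I \<in> cantor_set" "snd I \<in> cantor_set"
    "0 \<le> fst I" "snd I \<le> 1" "\<And>x. fst I < x \<Longrightarrow> x < snd I \<Longrightarrow> x \<notin> cantor_set"
  using assms cantor_gap_iff [of "fst I" "snd I"] cantor_set_subset by auto

lemma cantor_set_outside_gap:
  assumes "I \<in> cantor_gaps" "c \<in> cantor_set"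
  shows "c \<le> fst I \<or> snd I \<le> c"
  using cantor_gapD(6) [OF assms(1), of c] assms(2) by linarith

lemma cantor_gaps_disjoint:
  assumes "I \<in> cantor_gaps" "J \<in> cantor_gaps" "fst I < snd J" "fst J < snd I"
  shows "I = J"
  using cantor_set_outside_gap [OF assms(1) cantor_gapD(2) [OF assms(2)]]
    cantor_set_outside_gap [OF assms(1) cantor_gapD(3) [OF assms(2)]]
    cantor_set_outside_gap [OF assms(2) cantor_gapD(2) [OF assms(1)]]
    cantor_set_outside_gap [OF assms(2) cantor_gapD(3) [OF assms(1)]]
    cantor_gapD(1) [OF assms(1)] cantor_gapD(1) [OF assms(2)] assms(3,4)
  by (auto simp: prod_eq_iff)

lemma ex_cantor_gap:
  assumes "t \<in> {0..1}" "t \<notin> cantor_set"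
  shows "\<exists>I\<in>cantor_gaps. fst I < t \<and> t < snd I"
proof -
  have "compact (cantor_set \<inter> {0..t})" "compact (cantor_set \<inter> {t..1})"
    using closed_cantor_set by (auto intro: closed_Int_compact)
  moreover have "cantor_set \<inter> {0..t} \<noteq> {}" "cantor_set \<inter> {t..1} \<noteq> {}"
    using assms zero_in_cantor_set one_in_cantor_set by auto
  ultimately obtain a b where a: "a \<in> cantor_set \<inter> {0..t}" "\<forall>x\<in>cantor_set \<inter> {0..t}. x \<le> a"
    and b: "b \<in> cantor_set \<inter> {t..1}" "\<forall>x\<in>cantor_set \<inter> {t..1}. b \<le> x"
    using compact_attains_sup compact_attains_inf by metis
  then have less: "a < t" "t < b"
    using assms(2) by (auto simp: order_le_less)
  have "x \<notin> cantor_set" if "a < x" "x < b" for x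
    using that a b by (cases "x \<le> t") force+
  then have "(a, b) \<in> cantor_gaps"
    using a b less by (auto simp: cantor_gap_iff)
  with less show ?thesis
    by (intro bexI [of _ "(a, b)"]) auto
qed

lemma gap_of_eqI:
  assumes "I \<in> cantor_gaps" "fst I < t" "t < snd I"
  shows "gap_of t = I"
  unfolding gap_of_def
proof (rule the_equality)
  show "J = I" if "J \<in> cantor_gaps \<and> t \<in> {fst J<..<snd J}" for J
    using assms that by (intro cantor_gaps_disjoint) auto
qed (use assms in simp)

lemma gap_of:
  assumes "t \<in> {0..1}" "t \<notin> cantor_set"
  shows "gap_of t \<in> cantor_gaps" "fst (gap_of t) < t" "t < snd (gap_of t)"
  using ex_cantor_gap [OF assms] gap_of_eqI by auto

text \<open>The points \<open>1/3\<close> and \<open>2/3\<close> belong to the Cantor set, so a gap that meets the middle third fills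
  it, and every other gap is a copy, at a third of the size, of another one.\<close>

lemma cantor_gap_cases:
  assumes "(a, b) \<in> cantor_gaps"
  obtains "b \<le> 1/3" "(3 * a, 3 * b) \<in> cantor_gaps"
  | "a = 1/3" "b = 2/3"
  | "2/3 \<le> a" "(3 * a - 2, 3 * b - 2) \<in> cantor_gaps"
proof -
  have gap: "a < b" "a \<in> cantor_set" "b \<in> cantor_set" "\<And>x. a < x \<Longrightarrow> x < b \<Longrightarrow> x \<notin> cantor_set"
    using cantor_gapD [OF assms] by auto
  consider "b \<le> 1/3" | "2/3 \<le> a" | "1/3 < b" "a < 2/3"
    by linarith
  then show thesis
  proof cases
    case 1
    have "x \<notin> cantor_set" if "3 * a < x" "x < 3 * b" for x
      using gap(4) [of "x / 3"] cantor_set_left_third [of "x / 3"] 1 that by auto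
    then have "(3 * a, 3 * b) \<in> cantor_gaps"
      using gap 1 cantor_set_left_third by (auto simp: cantor_gap_iff)
    with 1 that(1) show ?thesis by blast
  next
    case 2
    have "x \<notin> cantor_set" if "3 * a - 2 < x" "x < 3 * b - 2" for x
    proof -
      have "3 * ((x + 2) / 3) - 2 = x" by (simp add: field_simps)
      then show ?thesis
        using gap(4) [of "(x + 2) / 3"] cantor_set_right_third [of "(x + 2) / 3"] 2 that by auto
    qed
    then have "(3 * a - 2, 3 * b - 2) \<in> cantor_gaps"
      using gap 2 cantor_set_right_third by (auto simp: cantor_gap_iff)
    with 2 that(3) show ?thesis by blast
  next
    case 3
    then have "1/3 \<le> a \<or> 2/3 \<le> a" "b \<le> 2/3"
      using cantor_set_outside_gap [OF assms third_in_cantor_set]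
        cantor_set_outside_gap [OF assms two_thirds_in_cantor_set]
        cantor_set_middle_third [of a] cantor_set_middle_third [of b] gap by fastforce+
    then have "a = 1/3" "b = 2/3"
      using 3 cantor_set_middle_third [of a] cantor_set_middle_third [of b] gap
      by (auto simp: not_less order.order_iff_strict)
    with that(2) show ?thesis by blast
  qed
qed

text \<open>Tripling a gap again and again, it must become the middle third at some stage, since its length
  stays below \<open>1\<close>.\<close>

lemma cantor_gap_length:
  assumes "I \<in> cantor_gaps"
  shows "\<exists>n\<ge>1. snd I - fst I = 1 / 3 ^ n"
proof -
  have "\<exists>n\<ge>1. b - a = 1 / 3 ^ n" if "(a, b) \<in> cantor_gaps" "1 / 3 ^ k \<le> b - a" for a b k
    using that
  proof (induction k arbitrary: a b)
    case 0
    then have "a = 0" "b = 1"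
      using cantor_gapD [of "(a, b)"] by auto
    then show ?case
      using cantor_gapD(6) [OF 0(1)] third_in_cantor_set by force
  next
    case (Suc k)
    have step: "\<exists>n\<ge>1. b - a = 1 / 3 ^ n" if cd: "(c, d) \<in> cantor_gaps" "d - c = 3 * (b - a)" for c d
    proof -
      have "1 / 3 ^ k \<le> d - c"
        using Suc.prems(2) unfolding cd(2) by (simp add: field_simps)
      then obtain n where "n \<ge> 1" "d - c = 1 / 3 ^ n"
        using Suc.IH [OF cd(1)] by blast
      with cd show ?thesis
        by (intro exI [of _ "Suc n"]) (simp add: field_simps)
    qed
    from Suc.prems(1) show ?case
    proof (cases rule: cantor_gap_cases)
      case 1
      with step show ?thesis by (simp add: algebra_simps)
    next
      case 2
      then show ?thesis by (intro exI [of _ 1]) simp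
    next
      case 3
      with step show ?thesis by (simp add: algebra_simps)
    qed
  qed
  moreover obtain k where "1 / 3 ^ k \<le> snd I - fst I"
    using real_arch_pow_inv [of "snd I - fst I" "1/3"] cantor_gapD(1) [OF assms]
    by (auto simp: power_one_over intro: less_imp_le)
  ultimately show ?thesis
    using assms by (metis prod.collapse)
qed

lemma gap_level:
  assumes "I \<in> cantor_gaps"
  shows "gap_level I \<ge> 1" "snd I - fst I = 1 / 3 ^ gap_level I"
proof -
  obtain n where n: "n \<ge> 1" "snd I - fst I = 1 / 3 ^ n"
    using cantor_gap_length [OF assms] by blast
  then have "gap_level I = n"
    unfolding gap_level_def by (intro the_equality) auto
  with n show "gap_level I \<ge> 1" "snd I - fst I = 1 / 3 ^ gap_level I"
    by auto
qed

text \<open>The left endpoints of these gaps are at least \<open>\<delta>\<close> apart.\<close>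

lemma finite_long_cantor_gaps:
  assumes "\<delta> > 0"
  shows "finite {I \<in> cantor_gaps. \<delta> \<le> snd I - fst I}" (is "finite ?L")
proof (rule finite_imageD)
  let ?g = "\<lambda>I. \<lfloor>fst I / \<delta>\<rfloor>"
  have "?g ` ?L \<subseteq> {0..\<lfloor>1 / \<delta>\<rfloor>}"
  proof (rule image_subsetI)
    fix I assume "I \<in> ?L"
    then have "0 \<le> fst I" "fst I \<le> 1"
      using cantor_gapD(1,4,5) [of I] by auto
    then show "?g I \<in> {0..\<lfloor>1 / \<delta>\<rfloor>}"
      using assms by (simp add: floor_mono divide_right_mono)
  qed
  then show "finite (?g ` ?L)"
    by (rule finite_subset) simp
  have less: "?g I < ?g J" if "I \<in> ?L" "J \<in> ?L" "fst I < fst J" for I J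
  proof -
    have "snd I \<le> fst J"
      using that cantor_set_outside_gap [of I "fst J"] cantor_gapD(2) [of J] by auto
    then have "(fst I + \<delta>) / \<delta> \<le> fst J / \<delta>"
      using that assms by (intro divide_right_mono) auto
    then have "fst I / \<delta> + 1 \<le> fst J / \<delta>"
      using assms by (simp add: add_divide_distrib)
    then show ?thesis by linarith
  qed
  show "inj_on ?g ?L"
  proof (rule inj_onI)
    fix I J assume IJ: "I \<in> ?L" "J \<in> ?L" "?g I = ?g J"
    then have "fst I = fst J"
      using less [of I J] less [of J I] by linarith
    then show "I = J"
      using IJ cantor_gapD(1) [of I] cantor_gapD(1) [of J] by (intro cantor_gaps_disjoint) auto
  qed
qed

text \<open>The subscript of the circle that \<open>l_tau\<close> traverses over the gap.\<close>

definition gap_index :: "real \<times> real \<Rightarrow> nat" where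
  "gap_index I = 2 ^ (gap_level I - 1) + gap_rank I - 1"

lemma gap_index_ge:
  assumes "I \<in> cantor_gaps"
  shows "2 ^ (gap_level I - 1) \<le> gap_index I"
proof -
  let ?S = "{J \<in> cantor_gaps. gap_level J = gap_level I \<and> fst J \<le> fst I}"
  have "?S \<subseteq> {J \<in> cantor_gaps. 1 / 3 ^ gap_level I \<le> snd J - fst J}"
    using gap_level(2) by fastforce
  then have "finite ?S"
    by (rule finite_subset) (simp add: finite_long_cantor_gaps)
  moreover have "I \<in> ?S"
    using assms by simp
  ultimately have "gap_rank I \<noteq> 0"
    unfolding gap_rank_def using card_eq_0_iff [of ?S] by blast
  then show ?thesis
    by (simp add: gap_index_def)
qed

lemma gap_index_pos: "I \<in> cantor_gaps \<Longrightarrow> gap_index I \<ge> 1"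
  using gap_index_ge [of I] one_le_power [of "2::nat" "gap_level I - 1"] by linarith

text \<open>Continuity is clear inside a gap. Near a point of the Cantor set, the gaps shorter than \<open>\<delta>\<close>
  contribute values close to \<open>p\<close>, and each of the finitely many longer ones either stays away from
  the point or has it as an endpoint.\<close>

lemma continuous_on_glue_gaps:
  fixes p :: "'b::metric_space"
  assumes cont: "\<And>I. I \<in> cantor_gaps \<Longrightarrow> continuous_on {fst I..snd I} (\<phi> I)"
    and ends: "\<And>I. I \<in> cantor_gaps \<Longrightarrow> \<phi> I (fst I) = p \<and> \<phi> I (snd I) = p"
    and small: "\<And>\<epsilon>. \<epsilon> > 0 \<Longrightarrow> \<exists>\<delta>>0. \<forall>I\<in>cantor_gaps. snd I - fst I < \<delta> \<longrightarrow>
                  (\<forall>t\<in>{fst I..snd I}. dist (\<phi> I t) p < \<epsilon>)"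
  shows "continuous_on {0..1} (\<lambda>t. if t \<in> cantor_set then p else \<phi> (gap_of t) t)"
proof -
  let ?F = "\<lambda>t. if t \<in> cantor_set then p else \<phi> (gap_of t) t"
  have F: "?F t = \<phi> I t" if "I \<in> cantor_gaps" "t \<in> {fst I..snd I}" for I t
  proof (cases "fst I < t \<and> t < snd I")
    case True
    then show ?thesis
      using gap_of_eqI [OF that(1)] cantor_gapD(6) [OF that(1)] by auto
  next
    case False
    then show ?thesis
      using ends [OF that(1)] that cantor_gapD(2,3) [OF that(1)] by (auto simp: not_less)
  qed
  have F_cont: "continuous_on {fst I..snd I} ?F" if "I \<in> cantor_gaps" for I
    using cont [OF that] F [OF that] by (subst continuous_on_cong) auto
  show ?thesis
    unfolding continuous_on_eq_continuous_within
  proof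
    fix t0 :: real assume t0: "t0 \<in> {0..1}"
    show "continuous (at t0 within {0..1}) ?F"
    proof (cases "t0 \<in> cantor_set")
      case False
      define I where "I = gap_of t0"
      have I: "I \<in> cantor_gaps" "t0 \<in> {fst I<..<snd I}"
        using gap_of [OF t0 False] by (auto simp: I_def)
      then have "continuous_on {fst I<..<snd I} ?F"
        using F_cont [OF I(1)] by (rule_tac continuous_on_subset) auto
      then have "continuous (at t0) ?F"
        using I by (simp add: continuous_on_eq_continuous_at)
      then show ?thesis
        by (rule continuous_at_imp_continuous_within)
    next
      case True
      have "\<forall>\<^sub>F t in at t0 within {0..1}. dist (?F t) (?F t0) < \<epsilon>" if \<epsilon>: "\<epsilon> > 0" for \<epsilon>
      proof -
        obtain \<delta> where \<delta>: "\<delta> > 0"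
          and short: "\<And>I t. I \<in> cantor_gaps \<Longrightarrow> snd I - fst I < \<delta> \<Longrightarrow> t \<in> {fst I..snd I} \<Longrightarrow> dist (\<phi> I t) p < \<epsilon>"
          using small [OF \<epsilon>] by blast
        let ?L = "{I \<in> cantor_gaps. \<delta> \<le> snd I - fst I}"
        have "\<forall>\<^sub>F t in at t0 within {0..1}. t \<in> {fst I..snd I} \<longrightarrow> dist (?F t) p < \<epsilon>" if "I \<in> ?L" for I
        proof (cases "t0 \<in> {fst I..snd I}")
          case True
          have "(?F \<longlongrightarrow> ?F t0) (at t0 within {fst I..snd I})"
            using F_cont [of I] that True by (auto simp: continuous_on_def)
          then have "\<forall>\<^sub>F t in at t0 within {fst I..snd I}. dist (?F t) (?F t0) < \<epsilon>"
            using \<epsilon> by (rule tendstoD)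
          then show ?thesis
            using \<open>t0 \<in> cantor_set\<close> unfolding eventually_at_filter
            by (auto elim: eventually_mono)
        next
          case False
          then have "\<forall>\<^sub>F t in nhds t0. t \<in> - {fst I..snd I}"
            by (intro eventually_nhds_in_open) auto
          then show ?thesis
            unfolding eventually_at_filter by (auto elim: eventually_mono)
        qed
        then have "\<forall>\<^sub>F t in at t0 within {0..1}. \<forall>I\<in>?L. t \<in> {fst I..snd I} \<longrightarrow> dist (?F t) p < \<epsilon>"
          using finite_long_cantor_gaps [OF \<delta>] by (intro eventually_ball_finite) auto
        moreover have "\<forall>\<^sub>F t in at t0 within {0..1}. t \<in> {0..1}"
          by (simp add: eventually_at_filter)
        ultimately show ?thesis
        proof eventually_elim
          case (elim t)
          have "dist (?F t) p < \<epsilon>"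
          proof (cases "t \<in> cantor_set")
            case False
            with elim(2) have I: "gap_of t \<in> cantor_gaps" "t \<in> {fst (gap_of t)..snd (gap_of t)}"
              using gap_of [of t] by auto
            show ?thesis
            proof (cases "\<delta> \<le> snd (gap_of t) - fst (gap_of t)")
              case True
              with elim(1) I show ?thesis by blast
            next
              case False
              then show ?thesis
                using short [OF I(1) _ I(2)] \<open>t \<notin> cantor_set\<close> by simp
            qed
          qed (use \<epsilon> in simp)
          then show ?case
            using \<open>t0 \<in> cantor_set\<close> by simp
        qed
      qed
      then show ?thesis
        by (simp add: continuous_within tendsto_iff)
    qed
  qed
qed

section \<open>Closedness with respect to \<open>\<W>\<close>\<close>

lemma semicircle_iff:
  fixes a b x y :: real
  assumes "a < b"
  shows "(x - (a + b) / 2)\<^sup>2 + y\<^sup>2 = ((b - a) / 2)\<^sup>2 \<and> y \<ge> 0 \<longleftrightarrow>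
    x \<in> {a..b} \<and> y = sqrt ((x - a) * (b - x))"
proof -
  have "(x - (a + b) / 2)\<^sup>2 + y\<^sup>2 = ((b - a) / 2)\<^sup>2 \<longleftrightarrow> y\<^sup>2 = (x - a) * (b - x)"
  proof -
    have "(x - (a + b) / 2)\<^sup>2 - ((b - a) / 2)\<^sup>2 = - ((x - a) * (b - x))"
      by (simp add: power2_eq_square field_simps)
    then show ?thesis by linarith
  qed
  moreover have "x \<in> {a..b} \<longleftrightarrow> 0 \<le> (x - a) * (b - x)"
    using assms by (auto simp: zero_le_mult_iff)
  ultimately show ?thesis
    by (metis real_sqrt_ge_zero real_sqrt_pow2 real_sqrt_unique zero_le_power2)
qed

lemma W_arc_iff: "a < b \<Longrightarrow> (x, y) \<in> W_arc (a, b) \<longleftrightarrow> x \<in> {a..b} \<and> y = sqrt ((x - a) * (b - x))"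
  using semicircle_iff [of a b x y] by (simp add: W_arc_def)

definition gap_height :: "(real \<times> real) set \<Rightarrow> real \<Rightarrow> real" where
  "gap_height S t = (if t \<in> cantor_set then 0
     else if gap_of t \<in> S then sqrt ((t - fst (gap_of t)) * (snd (gap_of t) - t)) else 0)"

text \<open>The arc from \<open>0\<close> to \<open>1\<close> in \<open>\<W>\<close> that takes the semicircle over the gaps in \<open>S\<close> and the straight
  line over all others. It interpolates between \<open>lambda_inf\<close> and \<open>upsilon_inf\<close>.\<close>

definition gap_arches :: "(real \<times> real) set \<Rightarrow> real \<Rightarrow> real \<times> real" where
  "gap_arches S t = (t, gap_height S t)"

lemma upsilon_inf_eq: "upsilon_inf = gap_arches UNIV"
  by (auto simp: fun_eq_iff upsilon_inf_def gap_arches_def gap_height_def split: prod.split)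

lemma lambda_inf_eq: "lambda_inf = gap_arches {}"
  by (auto simp: fun_eq_iff lambda_inf_def gap_arches_def gap_height_def)

lemma continuous_on_gap_height: "continuous_on {0..1} (gap_height S)"
proof -
  let ?\<phi> = "\<lambda>I t. if I \<in> S then sqrt ((t - fst I) * (snd I - t)) else (0 :: real)"
  have "continuous_on {0..1} (\<lambda>t. if t \<in> cantor_set then 0 else ?\<phi> (gap_of t) t)"
  proof (rule continuous_on_glue_gaps)
    show "continuous_on {fst I..snd I} (?\<phi> I)" for I
      by (cases "I \<in> S") (auto intro!: continuous_intros)
    show "?\<phi> I (fst I) = 0 \<and> ?\<phi> I (snd I) = 0" for I
      by simp
    show "\<exists>\<delta>>0. \<forall>I\<in>cantor_gaps. snd I - fst I < \<delta> \<longrightarrow> (\<forall>t\<in>{fst I..snd I}. dist (?\<phi> I t) 0 < \<epsilon>)"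
      if \<epsilon>: "\<epsilon> > 0" for \<epsilon>
    proof (intro exI [of _ \<epsilon>] conjI ballI impI)
      fix I t assume "snd I - fst I < \<epsilon>" "t \<in> {fst I..snd I}"
      then have "(t - fst I) * (snd I - t) \<le> (snd I - fst I) * (snd I - fst I)"
        by (intro mult_mono) auto
      then have "sqrt ((t - fst I) * (snd I - t)) \<le> snd I - fst I"
        using \<open>t \<in> {fst I..snd I}\<close> by (intro real_le_lsqrt) (auto simp: power2_eq_square)
      then show "dist (?\<phi> I t) 0 < \<epsilon>"
        using \<open>snd I - fst I < \<epsilon>\<close> \<epsilon> \<open>t \<in> {fst I..snd I}\<close> by auto
    qed (use \<epsilon> in auto)
  qed
  then show ?thesis
    by (simp add: gap_height_def [abs_def])
qed

lemma continuous_on_gap_arches: "continuous_on {0..1} (gap_arches S)"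
  unfolding gap_arches_def by (intro continuous_intros continuous_on_gap_height)

lemma gap_height_cantor [simp]: "t \<in> cantor_set \<Longrightarrow> gap_height S t = 0"
  by (simp add: gap_height_def)

lemma gap_height_pos: "t \<in> {0..1} \<Longrightarrow> t \<notin> cantor_set \<Longrightarrow> 0 < gap_height UNIV t"
  using gap_of [of t] by (simp add: gap_height_def)

lemma gap_height_cong:
  "(\<And>I. I \<in> cantor_gaps \<Longrightarrow> fst I < t \<Longrightarrow> t < snd I \<Longrightarrow> I \<in> S \<longleftrightarrow> I \<in> T) \<Longrightarrow> t \<in> {0..1} \<Longrightarrow>
   gap_height S t = gap_height T t"
  using gap_of [of t] by (auto simp: gap_height_def)

lemma W_space_eq: "W_space = lambda_inf ` {0..1} \<union> upsilon_inf ` {0..1}"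
proof -
  have line: "lambda_inf ` {0..1} = {0..1} \<times> {0}"
    by (auto simp: lambda_inf_def)
  have arc: "z \<in> upsilon_inf ` {0..1}" if Iz: "I \<in> cantor_gaps" "z \<in> W_arc I" for I z
  proof -
    obtain a b where I: "I = (a, b)" "a < b" "0 \<le> a" "b \<le> 1"
      using cantor_gapD [OF Iz(1)] by (cases I) auto
    obtain x y where z: "z = (x, y)" "x \<in> {a..b}" "y = sqrt ((x - a) * (b - x))"
      using Iz(2) I W_arc_iff by (cases z) auto
    have "z = upsilon_inf x"
    proof (cases "a < x \<and> x < b")
      case True
      then show ?thesis
        using gap_of_eqI [OF Iz(1), of x] cantor_gapD(6) [OF Iz(1), of x] I z
        by (simp add: upsilon_inf_eq gap_arches_def gap_height_def)
    next
      case False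
      then have "x = a \<or> x = b" using z by auto
      then show ?thesis
        using cantor_gapD(2,3) [OF Iz(1)] I z by (auto simp: upsilon_inf_eq gap_arches_def)
    qed
    then show ?thesis
      using z I by auto
  qed
  have "upsilon_inf t \<in> W_space" if t: "t \<in> {0..1}" for t
  proof (cases "t \<in> cantor_set")
    case True
    then show ?thesis
      using t by (auto simp: W_space_def upsilon_inf_eq gap_arches_def)
  next
    case False
    obtain a b where ab: "gap_of t = (a, b)"
      by fastforce
    then have "upsilon_inf t \<in> W_arc (a, b)"
      using gap_of [OF t False] False by (subst upsilon_inf_eq) (simp add: gap_arches_def gap_height_def W_arc_iff)
    then show ?thesis
      using gap_of(1) [OF t False] ab by (auto simp: W_space_def)
  qed
  then have "upsilon_inf ` {0..1} \<subseteq> W_space"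
    by blast
  moreover have "(\<Union>I\<in>cantor_gaps. W_arc I) \<subseteq> upsilon_inf ` {0..1}"
    using arc by blast
  ultimately show ?thesis
    unfolding W_space_def line by blast
qed

lemma gap_arches_in_W:
  assumes "t \<in> {0..1}"
  shows "gap_arches S t \<in> W_space"
proof -
  have "gap_arches S t = upsilon_inf t \<or> gap_arches S t = lambda_inf t"
    by (auto simp: upsilon_inf_eq lambda_inf_eq gap_arches_def gap_height_def)
  with assms show ?thesis
    by (auto simp: W_space_eq)
qed

lemma path_in_gap_arches: "path_in W_space (gap_arches S)"
  using continuous_on_gap_arches gap_arches_in_W by (simp add: path_in_iff)

lemma gap_arches_0 [simp]: "gap_arches S 0 = d0"
  using zero_in_cantor_set by (simp add: gap_arches_def d0_def)

lemma gap_arches_cantor: "t \<in> cantor_set \<Longrightarrow> gap_arches S t = gap_arches T t"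
  by (simp add: gap_arches_def)

lemma d0_in_W: "d0 \<in> W_space"
  using gap_arches_in_W [of 0 "{}"] by simp

context pi1_subgroup
begin

lemma coset_eq_cong:
  assumes "p \<doteq> q" "\<And>t. t \<in> {0..1} \<Longrightarrow> p t = p' t" "\<And>t. t \<in> {0..1} \<Longrightarrow> q t = q' t"
  shows "p' \<doteq> q'"
proof -
  note pq = coset_eqD [OF assms(1)]
  have "p \<doteq> p'" "q \<doteq> q'"
    by (rule coset_eq_homotopic [OF homotopic_paths_eqI]; use pq assms in simp)+
  with assms(1) show ?thesis
    using coset_eq_sym coset_eq_trans by blast
qed

lemma induced_map_in_H_iff:
  assumes "path_in T (p +++ reversepath q)" "continuous_on T f" "f ` T \<subseteq> X"
    "path_in T p" "path_in T q" "f (pathstart p) = x0" "pathstart q = pathstart p" "pathfinish p = pathfinish q"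
  shows "induced_map X f (path_class T (p +++ reversepath q)) \<in> H \<longleftrightarrow> f \<circ> p \<doteq> f \<circ> q"
proof -
  have "induced_map X f (path_class T (p +++ reversepath q)) = path_class X (f \<circ> (p +++ reversepath q))"
    using assms by (intro induced_map_path_class) (auto simp: path_in_def)
  then show ?thesis
    using assms path_in_continuous_image [OF assms(4,2,3)] path_in_continuous_image [OF assms(5,2,3)]
    by (simp add: coset_eq_def path_compose_join compose_reversepath pathstart_compose pathfinish_compose)
qed

text \<open>A generator of \<open>W_subgroup\<close> lands in \<open>H\<close> exactly if, after the prefix along \<open>upsilon_inf\<close>, the
  semicircle over the gap may be exchanged for the line without leaving the coset.\<close>

lemma W_generator_in_H_iff:
  assumes f: "continuous_on W_space f" "f ` W_space \<subseteq> X" "f d0 = x0" and I: "(a, b) \<in> cantor_gaps"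
  shows "induced_map X f (W_generator (a, b)) \<in> H \<longleftrightarrow>
    seg (f \<circ> upsilon_inf) 0 b \<doteq> seg (f \<circ> upsilon_inf) 0 a +++ seg (f \<circ> lambda_inf) a b"
proof -
  have ab: "a \<in> {0..1}" "b \<in> {0..1}" "a \<in> cantor_set" "b \<in> cantor_set"
    using cantor_gapD [OF I] by auto
  let ?p = "seg upsilon_inf 0 b" and ?q = "seg upsilon_inf 0 a +++ seg lambda_inf a b"
  have [simp]: "upsilon_inf 0 = d0" "lambda_inf a = upsilon_inf a" "lambda_inf b = upsilon_inf b"
    using gap_arches_cantor ab by (auto simp: upsilon_inf_eq lambda_inf_eq)
  have pq: "path_in W_space ?p" "path_in W_space ?q"
    using ab by (simp_all) (simp_all add: upsilon_inf_eq lambda_inf_eq path_in_gap_arches)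
  have "W_generator (a, b) = path_class W_space (?p +++ reversepath ?q)"
    by (simp add: W_generator_def subpath_eq_seg reversepath_joinpaths)
  then show ?thesis
    using induced_map_in_H_iff [of W_space ?p ?q f] f pq
    by (simp add: compose_seg path_compose_join)
qed

lemma w_inf_in_H_iff:
  assumes "continuous_on W_space f" "f ` W_space \<subseteq> X" "f d0 = x0"
  shows "induced_map X f w_inf \<in> H \<longleftrightarrow> f \<circ> upsilon_inf \<doteq> f \<circ> lambda_inf"
proof -
  have "pathstart upsilon_inf = d0" "pathstart lambda_inf = d0" "pathfinish upsilon_inf = pathfinish lambda_inf"
    using gap_arches_cantor [OF one_in_cantor_set]
    by (auto simp: upsilon_inf_eq lambda_inf_eq pathstart_def pathfinish_def)
  moreover have "path_in W_space upsilon_inf" "path_in W_space lambda_inf"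
    by (simp_all add: upsilon_inf_eq lambda_inf_eq path_in_gap_arches)
  ultimately show ?thesis
    unfolding w_inf_def using assms by (intro induced_map_in_H_iff) simp_all
qed

text \<open>A map out of \<open>\<W>\<close> amounts to two paths that agree on the Cantor set, namely \<open>\<beta>\<close> along the line
  and \<open>\<alpha>\<close> along \<open>upsilon_inf\<close>. Closedness then reads: if \<open>\<alpha>\<close> may be exchanged for \<open>\<beta>\<close> on any
  single gap, it may be exchanged on all of them at once.\<close>

lemma W_closed_coset_eq:
  assumes closed: "closed_wrt W_space d0 W_subgroup w_inf X x0 H"
    and \<alpha>: "path_in X \<alpha>" "\<alpha> 0 = x0" and \<beta>: "path_in X \<beta>" "\<beta> 0 = x0"
    and eq: "\<And>t. t \<in> cantor_set \<Longrightarrow> \<alpha> t = \<beta> t"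
    and gaps: "\<And>a b. (a, b) \<in> cantor_gaps \<Longrightarrow> seg \<alpha> 0 b \<doteq> seg \<alpha> 0 a +++ seg \<beta> a b"
  shows "\<alpha> \<doteq> \<beta>"
proof -
  (* off the Cantor set, upsilon_inf has positive height *)
  define f where "f z = (if snd z = 0 then \<beta> (fst z) else \<alpha> (fst z))" for z :: "real \<times> real"
  have lam: "f (lambda_inf t) = \<beta> t" for t
    by (simp add: f_def lambda_inf_def)
  have ups: "f (upsilon_inf t) = \<alpha> t" if "t \<in> {0..1}" for t
    using that eq gap_height_pos [of t]
    by (cases "t \<in> cantor_set") (auto simp: f_def upsilon_inf_eq gap_arches_def)
  have [simp]: "fst (lambda_inf t) = t" "fst (upsilon_inf t) = t" for t
    by (simp_all add: lambda_inf_def upsilon_inf_eq gap_arches_def)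
  have "closed (lambda_inf ` {0..1})" "closed (upsilon_inf ` {0..1})"
    by (auto simp: upsilon_inf_eq lambda_inf_eq
          intro!: compact_imp_closed compact_continuous_image continuous_on_gap_arches)
  moreover have "continuous_on (lambda_inf ` {0..1}) f"
  proof (subst continuous_on_cong [OF refl])
    show "continuous_on (lambda_inf ` {0..1}) (\<lambda>z. \<beta> (fst z))"
      using \<beta> by (auto simp: path_in_iff intro!: continuous_on_compose2 [of "{0..1}" \<beta>] continuous_intros)
  qed (auto simp: lam)
  moreover have "continuous_on (upsilon_inf ` {0..1}) f"
  proof (subst continuous_on_cong [OF refl])
    show "continuous_on (upsilon_inf ` {0..1}) (\<lambda>z. \<alpha> (fst z))"
      using \<alpha> by (auto simp: path_in_iff intro!: continuous_on_compose2 [of "{0..1}" \<alpha>] continuous_intros)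
  qed (auto simp: ups)
  ultimately have cont: "continuous_on W_space f"
    unfolding W_space_eq by (rule continuous_on_closed_Un)
  have im: "f ` W_space \<subseteq> X"
    using \<alpha> \<beta> lam ups by (auto simp: W_space_eq path_in_iff)
  have fd0: "f d0 = x0"
    using \<beta> by (simp add: f_def d0_def)
  have "induced_map X f ` W_subgroup \<subseteq> H"
    unfolding W_subgroup_def
  proof (rule induced_generate_subset [OF cont im fd0 d0_in_W])
    show "W_generator ` cantor_gaps \<subseteq> path_class W_space ` loops_at W_space d0"
    proof (rule image_subsetI)
      fix I assume "I \<in> cantor_gaps"
      moreover obtain a b where I: "I = (a, b)"
        by fastforce
      ultimately have ab: "a \<in> {0..1}" "b \<in> {0..1}" "a \<in> cantor_set" "b \<in> cantor_set"
        using cantor_gapD [of I] by auto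
      have "lambda_inf a = upsilon_inf a" "lambda_inf b = upsilon_inf b"
        using gap_arches_cantor ab by (auto simp: upsilon_inf_eq lambda_inf_eq)
      then have "seg upsilon_inf 0 b +++ reversepath (seg lambda_inf a b) +++ reversepath (seg upsilon_inf 0 a)
          \<in> loops_at W_space d0"
        using ab path_in_gap_arches by (simp add: loops_at_iff) (simp add: upsilon_inf_eq lambda_inf_eq)
      then show "W_generator I \<in> path_class W_space ` loops_at W_space d0"
        by (simp add: I W_generator_def subpath_eq_seg)
    qed
    show "induced_map X f ` W_generator ` cantor_gaps \<subseteq> H"
    proof clarify
      fix a b assume I: "(a, b) \<in> cantor_gaps"
      then have ab: "a \<in> {0..1}" "b \<in> {0..1}"
        using cantor_gapD [of "(a, b)"] by auto
      have 01: "linepath u v t \<in> {0..1}" if "u \<in> {0..1}" "v \<in> {0..1}" "t \<in> {0..1}" for u v t :: real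
        using linepath_in_01 [OF that(1,2)] that(3) by (auto simp: path_in_iff)
      have "seg (f \<circ> upsilon_inf) 0 b \<doteq> seg (f \<circ> upsilon_inf) 0 a +++ seg (f \<circ> lambda_inf) a b"
      proof (rule coset_eq_cong [OF gaps [OF I]])
        show "seg \<alpha> 0 b t = seg (f \<circ> upsilon_inf) 0 b t" if "t \<in> {0..1}" for t
          using 01 [of 0 b t] that ab by (simp add: seg_def ups)
        show "(seg \<alpha> 0 a +++ seg \<beta> a b) t = (seg (f \<circ> upsilon_inf) 0 a +++ seg (f \<circ> lambda_inf) a b) t"
          if "t \<in> {0..1}" for t
          using 01 [of 0 a "2 * t"] that ab by (simp add: seg_def joinpaths_def ups lam)
      qed
      then show "induced_map X f (W_generator (a, b)) \<in> H"
        using W_generator_in_H_iff [OF cont im fd0 I] by simp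
    qed
  qed
  then have "induced_map X f w_inf \<in> H"
    using closed cont im fd0 unfolding closed_wrt_def by blast
  then have "f \<circ> upsilon_inf \<doteq> f \<circ> lambda_inf"
    using w_inf_in_H_iff [OF cont im fd0] by simp
  then show ?thesis
    by (rule coset_eq_cong) (auto simp: ups lam)
qed

text \<open>The paths \<open>\<alpha>\<close> and \<open>\<beta>\<close> need not start at \<open>x0\<close>, if they are reached by a path \<open>c\<close>. By
  self-similarity one can rest on the first third, run along \<open>c\<close> over the middle gap, and squeeze
  \<open>\<alpha>\<close> or \<open>\<beta>\<close> into the last third.\<close>

lemma W_closed_coset_eq_join:
  assumes closed: "closed_wrt W_space d0 W_subgroup w_inf X x0 H"
    and c: "path_in X c" "c 0 = x0"
    and \<alpha>: "path_in X \<alpha>" "\<alpha> 0 = c 1" and \<beta>: "path_in X \<beta>" "\<beta> 0 = c 1"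
    and eq: "\<And>t. t \<in> cantor_set \<Longrightarrow> \<alpha> t = \<beta> t"
    and gaps: "\<And>a b. (a, b) \<in> cantor_gaps \<Longrightarrow> c +++ seg \<alpha> 0 b \<doteq> c +++ (seg \<alpha> 0 a +++ seg \<beta> a b)"
  shows "c +++ \<alpha> \<doteq> c +++ \<beta>"
proof -
  (* kappa is 0 up to 1/3, reaches 1/2, where c has been traversed, at 2/3, and is 1 at 1 *)
  define \<kappa> :: "real \<Rightarrow> real" where "\<kappa> t = max 0 ((3 * t - 1) / 2)" for t
  have \<kappa>: "path_in {0..1} \<kappa>"
    by (auto simp: path_in_iff \<kappa>_def intro!: continuous_intros)
  have \<kappa>0: "\<kappa> 0 = 0"
    by (simp add: \<kappa>_def)
  have ends: "pathfinish c = pathstart \<alpha>" "pathfinish c = pathstart \<beta>" "pathstart c = x0" "pathfinish c = c 1"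
    using \<alpha> \<beta> c by (auto simp: pathstart_def pathfinish_def)
  have path: "path_in X ((c +++ \<gamma>) \<circ> \<kappa>)" if "path_in X \<gamma>" "\<gamma> 0 = c 1" for \<gamma>
    using that c \<kappa> by (intro path_in_compose) (auto simp: pathstart_def pathfinish_def)
  have early: "((c +++ \<gamma>) \<circ> \<kappa>) t = c (2 * \<kappa> t)" if "t \<le> 2/3" for \<gamma> t
  proof -
    have "\<kappa> t \<le> 1/2"
      using that by (simp add: \<kappa>_def max_def)
    then show ?thesis
      by (simp add: joinpaths_def)
  qed
  have late: "((c +++ \<gamma>) \<circ> \<kappa>) t = \<gamma> (3 * t - 2)" if "2/3 \<le> t" "\<gamma> 0 = c 1" for \<gamma> t
  proof (cases "t = 2/3")
    case True
    show ?thesis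
      unfolding True using that by (simp add: joinpaths_def \<kappa>_def)
  next
    case False
    with that have \<kappa>t: "2 * \<kappa> t - 1 = 3 * t - 2" and "\<not> \<kappa> t \<le> 1/2"
      by (auto simp: \<kappa>_def field_simps)
    then have "((c +++ \<gamma>) \<circ> \<kappa>) t = \<gamma> (2 * \<kappa> t - 1)"
      by (simp add: joinpaths_def)
    then show ?thesis
      by (simp only: \<kappa>t)
  qed
  have initial: "homotopic_paths X (seg ((c +++ \<gamma>) \<circ> \<kappa>) 0 s) (c +++ seg \<gamma> 0 (3 * s - 2))"
    if \<gamma>: "path_in X \<gamma>" "\<gamma> 0 = c 1" and s: "2/3 \<le> s" "s \<le> 1" for \<gamma> s
  proof -
    let ?g = "linepath 0 (1/2) +++ linepath (1/2) ((3 * s - 1) / 2) :: real \<Rightarrow> real"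
    have g: "path_in {0..1} ?g"
      using s by (simp add: linepath_in_01)
    have c\<gamma>: "path_in X (c +++ \<gamma>)"
      using c \<gamma> by (simp add: pathstart_def pathfinish_def)
    have "homotopic_paths X ((c +++ \<gamma>) \<circ> (\<kappa> \<circ> linepath 0 s)) ((c +++ \<gamma>) \<circ> ?g)"
    proof (rule homotopic_paths_reparam [OF c\<gamma> _ g])
      show "path_in {0..1} (\<kappa> \<circ> linepath 0 s)"
        using s by (intro path_in_compose \<kappa> linepath_in_01) auto
    qed (use s in \<open>auto simp: pathstart_compose pathfinish_compose \<kappa>_def\<close>)
    also have "homotopic_paths X ((c +++ \<gamma>) \<circ> ?g) (c +++ seg \<gamma> 0 (3 * s - 2))"
    proof (rule homotopic_paths_eqI)
      show "path_in X ((c +++ \<gamma>) \<circ> ?g)"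
        by (rule path_in_compose [OF c\<gamma> g])
      show "((c +++ \<gamma>) \<circ> ?g) t = (c +++ seg \<gamma> 0 (3 * s - 2)) t" if t: "t \<in> {0..1}" for t
      proof (cases "t \<le> 1/2")
        case True
        then show ?thesis
          by (simp add: joinpaths_def linepath_def)
      next
        case False
        define r where "r = (2 * t - 1) * (3 * s - 2)"
        have "?g t = 1/2 + r / 2"
          using False by (simp add: joinpaths_def linepath_def r_def field_simps)
        then have "((c +++ \<gamma>) \<circ> ?g) t = (c +++ \<gamma>) (1/2 + r / 2)"
          by (simp only: o_apply)
        moreover have "0 \<le> r"
          using False s by (simp add: r_def)
        ultimately have "((c +++ \<gamma>) \<circ> ?g) t = \<gamma> r"
          using \<gamma>(2) by (cases "r = 0") (simp_all add: joinpaths_def del: o_apply)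
        also have "\<gamma> r = (c +++ seg \<gamma> 0 (3 * s - 2)) t"
          using False by (simp add: joinpaths_def seg_def linepath_def r_def)
        finally show ?thesis .
      qed
    qed
    finally show ?thesis
      by (simp add: seg_def comp_assoc)
  qed
  let ?\<alpha> = "(c +++ \<alpha>) \<circ> \<kappa>" and ?\<beta> = "(c +++ \<beta>) \<circ> \<kappa>"
  have \<alpha>': "path_in X ?\<alpha>" "?\<alpha> 0 = x0" and \<beta>': "path_in X ?\<beta>" "?\<beta> 0 = x0"
    using path \<alpha> \<beta> c by (auto simp: \<kappa>0 joinpaths_def)
  have "?\<alpha> \<doteq> ?\<beta>"
  proof (rule W_closed_coset_eq [OF closed \<alpha>' \<beta>'])
    show "?\<alpha> t = ?\<beta> t" if "t \<in> cantor_set" for t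
    proof (cases "t \<le> 2/3")
      case True
      then show ?thesis
        by (simp only: early)
    next
      case False
      then show ?thesis
        using late [of t \<alpha>] late [of t \<beta>] eq [of "3 * t - 2"] cantor_set_right_third [of t] that \<alpha> \<beta>
        by simp
    qed
    show "seg ?\<alpha> 0 b \<doteq> seg ?\<alpha> 0 a +++ seg ?\<beta> a b" if gap: "(a, b) \<in> cantor_gaps" for a b
    proof -
      have ab: "a < b" "0 \<le> a" "b \<le> 1" "a \<in> {0..1}" "b \<in> {0..1}"
        using cantor_gapD [OF gap] by auto
      have split: "seg ?\<alpha> 0 b \<doteq> seg ?\<alpha> 0 a +++ seg ?\<alpha> a b"
        using ab \<alpha>' by (intro coset_eq_sym [OF coset_eq_homotopic] homotopic_paths_seg_join) (auto simp: \<open>?\<alpha> 0 = x0\<close>)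
      from gap show ?thesis
      proof (cases rule: cantor_gap_cases)
        case 3
        have s: "c +++ seg \<alpha> 0 (3 * b - 2) \<doteq> c +++ (seg \<alpha> 0 (3 * a - 2) +++ seg \<beta> (3 * a - 2) (3 * b - 2))"
          by (rule gaps [OF 3(2)])
        have 01: "3 * a - 2 \<in> {0..1}" "3 * b - 2 \<in> {0..1}" "\<alpha> (3 * a - 2) = \<beta> (3 * a - 2)"
          using ab 3 eq cantor_gapD(2) [OF 3(2)] by auto
        have "seg ?\<alpha> 0 b \<doteq> c +++ seg \<alpha> 0 (3 * b - 2)"
          using ab 3 \<alpha> \<open>?\<alpha> 0 = x0\<close> by (intro coset_eq_homotopic initial) auto
        also have "\<dots> \<doteq> c +++ (seg \<alpha> 0 (3 * a - 2) +++ seg \<beta> (3 * a - 2) (3 * b - 2))"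
          by (rule s)
        also have "\<dots> \<doteq> (c +++ seg \<alpha> 0 (3 * a - 2)) +++ seg \<beta> (3 * a - 2) (3 * b - 2)"
          using 01 c \<alpha> \<beta> ends by (intro coset_eq_sym [OF coset_eq_homotopic] homotopic_paths_assoc') auto
        also have "\<dots> \<doteq> seg ?\<alpha> 0 a +++ seg \<beta> (3 * a - 2) (3 * b - 2)"
          using 01 ab 3 \<alpha> \<beta> \<open>?\<alpha> 0 = x0\<close>
          by (intro coset_eq_join coset_eq_sym [OF coset_eq_homotopic] initial) auto
        finally show ?thesis
        proof (rule coset_eq_cong)
          have "linepath a b t \<ge> 2/3" if "t \<in> {0..1}" for t
          proof -
            have "linepath a b t = a + t * (b - a)"
              by (simp add: linepath_def algebra_simps)
            moreover have "0 \<le> t * (b - a)"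
              using that ab by simp
            ultimately show ?thesis
              using 3(1) by linarith
          qed
          moreover have "3 * linepath a b t - 2 = linepath (3 * a - 2) (3 * b - 2) t" for t
            by (simp add: linepath_def algebra_simps)
          ultimately have "seg ?\<beta> a b t = seg \<beta> (3 * a - 2) (3 * b - 2) t" if "t \<in> {0..1}" for t
            unfolding seg_def o_apply [of _ "linepath _ _"] using late [of "linepath a b t" \<beta>] \<beta> that by metis
          then show "(seg ?\<alpha> 0 a +++ seg \<beta> (3 * a - 2) (3 * b - 2)) t = (seg ?\<alpha> 0 a +++ seg ?\<beta> a b) t"
            if "t \<in> {0..1}" for t
            using that by (simp add: joinpaths_def del: o_apply)
        qed simp
      next
        case 1
        then have "b \<le> 2/3" by simp
        then have "linepath a b t \<le> 2/3" if "t \<in> {0..1}" for t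
          using that ab convex_bound_le [of a "2/3" b "1 - t" t] by (simp add: linepath_def)
        then have "seg ?\<alpha> a b t = seg ?\<beta> a b t" if "t \<in> {0..1}" for t
          using that early by (simp add: seg_def)
        then show ?thesis
          by (intro coset_eq_cong [OF split]) (simp_all add: joinpaths_def)
      next
        case 2
        then have "b \<le> 2/3" by simp
        then have "linepath a b t \<le> 2/3" if "t \<in> {0..1}" for t
          using that ab convex_bound_le [of a "2/3" b "1 - t" t] by (simp add: linepath_def)
        then have "seg ?\<alpha> a b t = seg ?\<beta> a b t" if "t \<in> {0..1}" for t
          using that early by (simp add: seg_def)
        then show ?thesis
          by (intro coset_eq_cong [OF split]) (simp_all add: joinpaths_def)
      qed
    qed
  qed
  moreover have "?\<alpha> \<doteq> c +++ \<alpha>"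
    by (rule coset_eq_homotopic) (use initial [of \<alpha> 1] \<alpha> \<alpha>'(2) in \<open>simp_all add: pathstart_def del: o_apply\<close>)
  moreover have "?\<beta> \<doteq> c +++ \<beta>"
    by (rule coset_eq_homotopic) (use initial [of \<beta> 1] \<beta> \<beta>'(2) in \<open>simp_all add: pathstart_def del: o_apply\<close>)
  ultimately show ?thesis
    using coset_eq_sym coset_eq_trans by blast
qed

end

section \<open>Infinite products of circles in \<open>\<H>\<^sup>+\<close>\<close>

text \<open>The loop \<open>l_tau\<close> with its circles renumbered by \<open>\<sigma>\<close>, which covers \<open>l_tau\<close> itself as well as
  its images under \<open>f_odd\<close> and \<open>f_even\<close>.\<close>

definition tau_loop :: "(nat \<Rightarrow> nat) \<Rightarrow> real \<Rightarrow> real \<times> real" where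
  "tau_loop \<sigma> t = (if t \<in> cantor_set then b0
     else H_loop (\<sigma> (gap_index (gap_of t))) ((t - fst (gap_of t)) / (snd (gap_of t) - fst (gap_of t))))"

lemma H_loop_ends [simp]: "H_loop n 0 = b0" "H_loop n 1 = b0"
proof -
  have "cos (pi + 2 * pi) = -1" "sin (pi + 2 * pi) = 0"
    using cos_periodic [of pi] sin_periodic [of pi] by simp_all
  then show "H_loop n 0 = b0" "H_loop n 1 = b0"
    by (simp_all add: H_loop_def b0_def)
qed

lemma H_loop_in_H_space: "n \<ge> 1 \<Longrightarrow> H_loop n t \<in> H_space"
proof -
  assume "n \<ge> 1"
  have "(1 / real n * cos z)\<^sup>2 + (1 / real n * sin z)\<^sup>2 = (1 / real n)\<^sup>2" for z
    using sin_cos_squared_add [of z] by (simp only: power_mult_distrib flip: distrib_left) simp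
  then have "H_loop n t \<in> H_circle n"
    by (simp add: H_circle_def H_loop_def)
  with \<open>n \<ge> 1\<close> show ?thesis
    by (auto simp: H_space_def)
qed

lemma continuous_on_H_loop: "continuous_on A (H_loop n)"
  unfolding H_loop_def by (intro continuous_intros)

lemma path_in_H_loop: "n \<ge> 1 \<Longrightarrow> path_in Hplus_space (H_loop n)"
  using H_loop_in_H_space continuous_on_H_loop by (auto simp: path_in_iff Hplus_space_def)

lemma dist_H_loop: "dist (H_loop n t) b0 \<le> 3 / real n"
proof -
  let ?z = "pi + 2 * pi * t"
  have le: "norm (1 / real n * c) \<le> 1 / real n" if "\<bar>c\<bar> \<le> 1" for c
    using that by (simp add: abs_mult divide_right_mono)
  have "norm (H_loop n t) \<le> norm (1 / real n + 1 / real n * cos ?z) + norm (1 / real n * sin ?z)"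
    unfolding H_loop_def by (rule norm_Pair_le)
  also have "norm (1 / real n + 1 / real n * cos ?z) \<le> 1 / real n + 1 / real n"
    using le [of "cos ?z"] by (intro order_trans [OF norm_triangle_ineq] add_mono) auto
  also have "norm (1 / real n * sin ?z) \<le> 1 / real n"
    by (rule le) simp
  finally show ?thesis
    by (simp add: b0_def zero_prod_def [symmetric] dist_norm)
qed

lemma b0_in_H_space: "b0 \<in> H_space"
  using H_loop_in_H_space [of 1 0] by simp

text \<open>Short gaps have a high level, hence a large index, so their circles are small.\<close>

lemma path_in_tau_loop:
  assumes \<sigma>: "\<And>k. k \<le> \<sigma> k"
  shows "path_in Hplus_space (tau_loop \<sigma>)"
proof -
  let ?\<phi> = "\<lambda>I t. H_loop (\<sigma> (gap_index I)) ((t - fst I) / (snd I - fst I))"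
  have "continuous_on {0..1} (\<lambda>t. if t \<in> cantor_set then b0 else ?\<phi> (gap_of t) t)"
  proof (rule continuous_on_glue_gaps)
    fix I assume I: "I \<in> cantor_gaps"
    note less = cantor_gapD(1) [OF I]
    show "continuous_on {fst I..snd I} (?\<phi> I)"
      using less by (intro continuous_on_compose2 [OF continuous_on_H_loop [of UNIV]] continuous_intros) auto
    show "?\<phi> I (fst I) = b0 \<and> ?\<phi> I (snd I) = b0"
      using less by simp
  next
    fix \<epsilon> :: real assume \<epsilon>: "\<epsilon> > 0"
    then obtain N where N: "(1 / 2) ^ N < \<epsilon> / 3"
      using real_arch_pow_inv [of "\<epsilon> / 3" "1/2"] by auto
    show "\<exists>\<delta>>0. \<forall>I\<in>cantor_gaps. snd I - fst I < \<delta> \<longrightarrow> (\<forall>t\<in>{fst I..snd I}. dist (?\<phi> I t) b0 < \<epsilon>)"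
    proof (intro exI [of _ "1 / 3 ^ N"] conjI ballI impI)
      fix I t assume I: "I \<in> cantor_gaps" and "snd I - fst I < 1 / 3 ^ N"
      then have "(3::real) ^ N < 3 ^ gap_level I"
        using gap_level(2) [OF I] by (simp add: field_simps)
      then have "N \<le> gap_level I - 1"
        by simp
      then have "(2::nat) ^ N \<le> \<sigma> (gap_index I)"
        using gap_index_ge [OF I] \<sigma> power_increasing [of N "gap_level I - 1" "2::nat"] order_trans
        by (metis one_le_numeral)
      then have "(2::real) ^ N \<le> real (\<sigma> (gap_index I))"
        by (metis of_nat_le_iff of_nat_numeral of_nat_power)
      then have "3 / real (\<sigma> (gap_index I)) \<le> 3 / 2 ^ N"
        by (intro divide_left_mono mult_pos_pos) (auto intro: less_le_trans [of 0 "2 ^ N"])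
      also have "\<dots> < \<epsilon>"
        using N by (simp add: field_simps power_one_over)
      finally show "dist (?\<phi> I t) b0 < \<epsilon>"
        using dist_H_loop [of "\<sigma> (gap_index I)" "(t - fst I) / (snd I - fst I)"] by linarith
    qed auto
  qed
  moreover have "tau_loop \<sigma> t \<in> Hplus_space" if "t \<in> {0..1}" for t
  proof -
    have "t \<notin> cantor_set \<Longrightarrow> \<sigma> (gap_index (gap_of t)) \<ge> 1"
      using gap_index_pos [OF gap_of(1) [OF that]] \<sigma> order_trans by blast
    then show ?thesis
      using b0_in_H_space H_loop_in_H_space by (simp add: tau_loop_def Hplus_space_def)
  qed
  ultimately show ?thesis
    by (simp add: path_in_iff tau_loop_def [abs_def])
qed

lemma seg_tau_loop:
  assumes "(a, b) \<in> cantor_gaps" "s \<in> {0..1}"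
  shows "seg (tau_loop \<sigma>) a b s = H_loop (\<sigma> (gap_index (a, b))) s"
proof -
  have ab: "a < b" "a \<in> cantor_set" "b \<in> cantor_set"
    using cantor_gapD [OF assms(1)] by auto
  consider "s = 0" | "s = 1" | "0 < s" "s < 1"
    using assms(2) by fastforce
  then show ?thesis
  proof cases
    case 3
    define t where "t = linepath a b s"
    have t: "t = a + s * (b - a)"
      by (simp add: t_def linepath_def algebra_simps)
    moreover have "0 < s * (b - a)" "s * (b - a) < 1 * (b - a)"
      using ab 3 by (simp, intro mult_strict_right_mono) auto
    ultimately have "a < t" "t < b"
      by simp_all
    then have "gap_of t = (a, b)" "t \<notin> cantor_set"
      using gap_of_eqI [OF assms(1)] cantor_gapD(6) [OF assms(1)] by auto
    then show ?thesis
      using ab by (simp add: seg_def tau_loop_def flip: t_def) (simp add: t)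
  qed (use ab in \<open>simp_all add: seg_def tau_loop_def linepath_def\<close>)
qed

lemma tau_loop_cantor [simp]: "t \<in> cantor_set \<Longrightarrow> tau_loop \<sigma> t = b0"
  by (simp add: tau_loop_def)

lemma l_tau_eq: "l_tau = tau_loop (\<lambda>k. k)"
  by (simp add: fun_eq_iff l_tau_def tau_loop_def gap_index_def Let_def)

lemma H_reindex_l_tau:
  assumes "t \<in> {0..1}"
  shows "H_reindex \<sigma> (l_tau t) = tau_loop \<sigma> t"
proof (cases "t \<in> cantor_set")
  case True
  then show ?thesis
    using H_reindex_H_loop [of 1 0 \<sigma>] by (simp add: l_tau_eq)
next
  case False
  then have "gap_index (gap_of t) \<ge> 1" "(t - fst (gap_of t)) / (snd (gap_of t) - fst (gap_of t)) \<in> {0..1}"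
    using gap_of [OF assms False] gap_index_pos by auto
  then show ?thesis
    using False by (simp add: l_tau_eq tau_loop_def H_reindex_H_loop)
qed

lemma path_in_whisker: "path_in Hplus_space whisker"
  by (auto simp: path_in_iff whisker_def Hplus_space_def intro!: continuous_intros)

lemma whisker_ends [simp]: "whisker 0 = b0_plus" "whisker 1 = b0"
  and pathstart_whisker [simp]: "pathstart whisker = b0_plus"
  and pathfinish_whisker [simp]: "pathfinish whisker = b0"
  by (simp_all add: whisker_def b0_plus_def b0_def pathstart_def pathfinish_def)

context pi1_subgroup
begin

lemma coset_eq_join_iff:
  assumes "path_in X c" "path_in X p" "pathstart c = x0"
    "pathfinish c = pathstart p" "pathfinish p = pathfinish c"
  shows "c +++ p \<doteq> c \<longleftrightarrow> path_class X (c +++ (p +++ reversepath c)) \<in> H"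
proof -
  have "homotopic_paths X ((c +++ p) +++ reversepath c) (c +++ (p +++ reversepath c))"
    using assms by (intro homotopic_paths_assoc') auto
  then show ?thesis
    using assms path_class_homotopic_in_H by (simp add: coset_eq_def)
qed

context
  fixes f :: "real \<times> real \<Rightarrow> 'a"
  assumes f: "continuous_on Hplus_space f" "f ` Hplus_space \<subseteq> X" "f b0_plus = x0"
begin

lemma path_in_f: "path_in Hplus_space p \<Longrightarrow> path_in X (f \<circ> p)"
  using f by (intro path_in_continuous_image) auto

lemma f_path_class: "path_in Hplus_space p \<Longrightarrow> induced_map X f (path_class Hplus_space p) = path_class X (f \<circ> p)"
  using f by (intro induced_map_path_class) (auto simp: path_in_def)

lemma whisker_f: "path_in X (f \<circ> whisker)" "(f \<circ> whisker) 0 = x0"  "(f \<circ> whisker) 1 = f b0"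
   "pathstart (f \<circ> whisker) = x0" "pathfinish (f \<circ> whisker) = f b0"
  using f path_in_f [OF path_in_whisker] by (auto simp: pathstart_def pathfinish_def)

lemma c_class_in_H_iff:
  assumes "path_in Hplus_space l" "l 0 = b0" "l 1 = b0"
  shows "induced_map X f (path_class Hplus_space (whisker +++ l +++ reversepath whisker)) \<in> H \<longleftrightarrow>
    (f \<circ> whisker) +++ (f \<circ> l) \<doteq> f \<circ> whisker"
proof -
  have "pathstart l = b0" "pathfinish l = b0"
    using assms by (simp_all add: pathstart_def pathfinish_def)
  then have "path_in Hplus_space (whisker +++ l +++ reversepath whisker)"
    using assms path_in_whisker by simp
  then show ?thesis
    using assms whisker_f path_in_f [OF assms(1)]
    by (subst coset_eq_join_iff)
       (auto simp: f_path_class path_compose_join compose_reversepath pathstart_def pathfinish_def)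
qed

lemma p_class_in_H_iff:
  assumes "path_in Hplus_space k" "path_in Hplus_space l" "k 0 = b0" "k 1 = b0" "l 0 = b0" "l 1 = b0"
  shows "induced_map X f (path_class Hplus_space (whisker +++ k +++ reversepath l +++ reversepath whisker)) \<in> H \<longleftrightarrow>
    (f \<circ> whisker) +++ (f \<circ> k) \<doteq> (f \<circ> whisker) +++ (f \<circ> l)"
proof -
  have "pathstart k = b0" "pathfinish k = b0" "pathstart l = b0" "pathfinish l = b0"
    using assms by (simp_all add: pathstart_def pathfinish_def)
  then have "path_in Hplus_space (whisker +++ k +++ reversepath l +++ reversepath whisker)"
    using assms path_in_whisker by simp
  then show ?thesis
    using assms whisker_f path_in_f [OF assms(1)] path_in_f [OF assms(2)]
    by (subst coset_eq_iff_three)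
       (auto simp: f_path_class path_compose_join compose_reversepath pathstart_def pathfinish_def)
qed

text \<open>Here \<open>\<alpha>\<close> is constant and \<open>\<beta>\<close> is the image of \<open>l_tau\<close>. The prefix before each gap runs along \<open>\<alpha>\<close>
  and is therefore trivial, so that the assumption on a gap concerns a single generator of
  \<open>C_subgroup\<close>. With the roles exchanged, conjugates of generators would appear.\<close>

lemma c_tau_in_H:
  assumes closed: "closed_wrt W_space d0 W_subgroup w_inf X x0 H"
    and C: "induced_map X f ` C_subgroup \<subseteq> H"
  shows "induced_map X f c_tau \<in> H"
proof -
  let ?c = "f \<circ> whisker" and ?\<beta> = "f \<circ> l_tau" and ?e = "\<lambda>_. f b0"
  have l_tau: "path_in Hplus_space l_tau" "l_tau 0 = b0" "l_tau 1 = b0"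
    using path_in_tau_loop [of "\<lambda>k. k"] zero_in_cantor_set one_in_cantor_set by (simp_all add: l_tau_eq)
  have b0: "f b0 \<in> X"
    using f b0_in_H_space by (auto simp: Hplus_space_def)
  have const: "?c +++ ?e \<doteq> ?c"
    using whisker_f b0 by (intro coset_eq_homotopic homotopic_paths_join_const) auto
  have loop: "?c \<doteq> ?c +++ (f \<circ> H_loop k)" if "k \<ge> 1" for k
  proof -
    have "C_generator k \<in> C_subgroup"
      using that unfolding C_subgroup_def by (intro generate.incl) auto
    then have "induced_map X f (C_generator k) \<in> H"
      using C by blast
    then show ?thesis
      unfolding C_generator_def using path_in_H_loop [OF that]
      by (subst (asm) c_class_in_H_iff) (simp_all add: coset_eq_sym)
  qed
  have "?c +++ ?e \<doteq> ?c +++ ?\<beta>"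
  proof (rule W_closed_coset_eq_join [OF closed])
    show "?e t = ?\<beta> t" if "t \<in> cantor_set" for t
      using that by (simp add: l_tau_eq)
    show "?c +++ seg ?e 0 b \<doteq> ?c +++ (seg ?e 0 a +++ seg ?\<beta> a b)" if I: "(a, b) \<in> cantor_gaps" for a b
    proof -
      let ?l = "f \<circ> H_loop (gap_index (a, b))"
      have [simp]: "seg ?e u v = ?e" for u v
        by (simp add: seg_def fun_eq_iff)
      have l: "path_in X ?l" "pathstart ?l = f b0"
        using path_in_f [OF path_in_H_loop [OF gap_index_pos [OF I]]] by (auto simp: pathstart_def)
      have "?c +++ ?e \<doteq> ?c"
        by (rule const)
      also have "?c \<doteq> ?c +++ ?l"
        using loop [OF gap_index_pos [OF I]] .
      also have "?c +++ ?l \<doteq> ?c +++ (?e +++ ?l)"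
        using l whisker_f b0
        by (intro coset_eq_sym [OF coset_eq_homotopic] homotopic_paths_join_right homotopic_paths_const_join) auto
      finally show ?thesis
      proof (rule coset_eq_cong)
        show "(?c +++ (?e +++ ?l)) t = (?c +++ (seg ?e 0 a +++ seg ?\<beta> a b)) t" if "t \<in> {0..1}" for t
          using that seg_tau_loop [OF I, of _ "\<lambda>k. k"]
          by (simp add: joinpaths_def l_tau_eq flip: compose_seg)
      qed simp
    qed
  qed (use whisker_f b0 path_in_f [OF l_tau(1)] l_tau in auto)
  then have "?c +++ ?\<beta> \<doteq> ?c"
    using const coset_eq_sym coset_eq_trans by blast
  then show ?thesis
    unfolding c_tau_def using c_class_in_H_iff [OF l_tau] by simp
qed

text \<open>On a gap, the odd circle is to be exchanged for the even one after a prefix \<open>A\<close> that runs through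
  infinitely many odd circles. This asks for the conjugate by \<open>A\<close> of a generator of \<open>P_subgroup\<close>
  to be mapped into \<open>H\<close>, which follows by normality.\<close>

lemma p_tau_in_H:
  assumes closed: "closed_wrt W_space d0 W_subgroup w_inf X x0 H"
    and normal: "H \<lhd> fundamental_group X x0"
    and P: "induced_map X f ` P_subgroup \<subseteq> H"
  shows "induced_map X f p_tau \<in> H"
proof -
  let ?c = "f \<circ> whisker"
  define odd_tau even_tau where "odd_tau = tau_loop (\<lambda>k. 2 * k - 1)" and "even_tau = tau_loop (\<lambda>k. 2 * k)"
  let ?\<alpha> = "f \<circ> odd_tau" and ?\<beta> = "f \<circ> even_tau"
  have tau: "path_in Hplus_space odd_tau" "path_in Hplus_space even_tau"
    unfolding odd_tau_def even_tau_def by (intro path_in_tau_loop; simp)+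
  have tau0: "odd_tau t = b0" "even_tau t = b0" if "t \<in> cantor_set" for t
    using that by (simp_all add: odd_tau_def even_tau_def)
  note ends = tau0 [OF zero_in_cantor_set] tau0 [OF one_in_cantor_set]
  have loops: "?c +++ (f \<circ> H_loop (2 * k - 1)) \<doteq> ?c +++ (f \<circ> H_loop (2 * k))" if "k \<ge> 1" for k
  proof -
    have "P_generator k \<in> P_subgroup"
      using that unfolding P_subgroup_def by (intro generate.incl) auto
    then have "induced_map X f (P_generator k) \<in> H"
      using P by blast
    then show ?thesis
      unfolding P_generator_def using that
      by (subst (asm) p_class_in_H_iff) (simp_all add: path_in_H_loop)
  qed
  have "?c +++ ?\<alpha> \<doteq> ?c +++ ?\<beta>"
  proof (rule W_closed_coset_eq_join [OF closed])
    show "?\<alpha> t = ?\<beta> t" if "t \<in> cantor_set" for t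
      using tau0 [OF that] by simp
    show "?c +++ seg ?\<alpha> 0 b \<doteq> ?c +++ (seg ?\<alpha> 0 a +++ seg ?\<beta> a b)" if I: "(a, b) \<in> cantor_gaps" for a b
    proof -
      have ab: "a \<in> {0..1}" "b \<in> {0..1}" "a \<in> cantor_set"
        using cantor_gapD [OF I] by auto
      let ?A = "seg ?\<alpha> 0 a"
      define k where "k = gap_index (a, b)"
      have k: "k \<ge> 1"
        using gap_index_pos [OF I] by (simp add: k_def)
      let ?o = "f \<circ> H_loop (2 * k - 1)" and ?e = "f \<circ> H_loop (2 * k)"
      have oe: "path_in X ?o" "path_in X ?e" "pathstart ?o = f b0" "pathstart ?e = f b0"
        using k by (auto intro!: path_in_f path_in_H_loop simp: pathstart_def)
      have A: "path_in X ?A" "?\<alpha> a = f b0" "?\<alpha> 0 = f b0"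
        using path_in_f [OF tau(1)] ab tau0 ends by auto
      let ?l = "(?c +++ ?A) +++ reversepath ?c"
      have move: "?l +++ (?c +++ p) \<doteq> ?c +++ (?A +++ p)" if "path_in X p" "pathstart p = f b0" for p
      proof -
        have "?l +++ (?c +++ p) \<doteq> (?c +++ ?A) +++ p"
          using homotopic_paths_cancel_middle [of X "?c +++ ?A" "reversepath ?c" p] that A whisker_f
          by (intro coset_eq_homotopic) auto
        also have "(?c +++ ?A) +++ p \<doteq> ?c +++ (?A +++ p)"
          using that A whisker_f by (intro coset_eq_homotopic homotopic_paths_assoc') auto
        finally show ?thesis .
      qed
      have lloop: "?l \<in> loops_at X x0"
        using A whisker_f by (simp add: loops_at_iff)
      have "?c +++ (?A +++ ?o) \<doteq> ?l +++ (?c +++ ?o)"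
        using oe by (intro coset_eq_sym [OF move])
      also have "\<dots> \<doteq> ?l +++ (?c +++ ?e)"
        by (rule coset_eq_normal_join [OF normal loops [OF k] lloop])
      also have "\<dots> \<doteq> ?c +++ (?A +++ ?e)"
        using oe by (intro move)
      finally have 1: "?c +++ (?A +++ seg ?\<alpha> a b) \<doteq> ?c +++ (?A +++ seg ?\<beta> a b)"
      proof (rule coset_eq_cong)
        fix t :: real assume "t \<in> {0..1}"
        then show "(?c +++ (?A +++ ?o)) t = (?c +++ (?A +++ seg ?\<alpha> a b)) t"
          "(?c +++ (?A +++ ?e)) t = (?c +++ (?A +++ seg ?\<beta> a b)) t"
          using seg_tau_loop [OF I]
          by (simp_all add: joinpaths_def odd_tau_def even_tau_def k_def flip: compose_seg)
      qed
      have "?c +++ seg ?\<alpha> 0 b \<doteq> ?c +++ (?A +++ seg ?\<alpha> a b)"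
        using ab A whisker_f path_in_f [OF tau(1)]
        by (intro coset_eq_sym [OF coset_eq_homotopic] homotopic_paths_join_right homotopic_paths_seg_join) auto
      from coset_eq_trans [OF this 1] show ?thesis .
    qed
  qed (use whisker_f path_in_f tau ends in auto)
  then have "induced_map X f (path_class Hplus_space
      (whisker +++ odd_tau +++ reversepath even_tau +++ reversepath whisker)) \<in> H"
    using tau ends by (subst p_class_in_H_iff) simp_all
  moreover have "path_class Hplus_space (whisker +++ odd_tau +++ reversepath even_tau +++ reversepath whisker) = p_tau"
    unfolding p_tau_def
  proof (rule path_class_eq [OF homotopic_paths_eqI])
    have "pathstart odd_tau = b0" "pathfinish odd_tau = b0" "pathstart even_tau = b0" "pathfinish even_tau = b0"
      using ends by (simp_all add: pathstart_def pathfinish_def)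
    then show "path_in Hplus_space (whisker +++ odd_tau +++ reversepath even_tau +++ reversepath whisker)"
      using path_in_whisker tau by simp
    have "odd_tau t = (f_odd \<circ> l_tau) t" "even_tau t = (f_even \<circ> l_tau) t" if "t \<in> {0..1}" for t
      using that by (simp_all add: odd_tau_def even_tau_def f_odd_def f_even_def H_reindex_l_tau)
    then show "(whisker +++ odd_tau +++ reversepath even_tau +++ reversepath whisker) t =
       (whisker +++ (f_odd \<circ> l_tau) +++ reversepath (f_even \<circ> l_tau) +++ reversepath whisker) t"
      if "t \<in> {0..1}" for t
      using that by (simp add: joinpaths_def reversepath_def del: o_apply)
  qed
  ultimately show ?thesis
    by simp
qed

end

end

section \<open>Mapping \<open>\<D>\<close> to \<open>\<W>\<close>\<close>

definition dyadic_lo :: "nat \<Rightarrow> nat \<Rightarrow> real" where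
  "dyadic_lo n j = (real j - 1) / 2 ^ (n - 1)"

definition dyadic_hi :: "nat \<Rightarrow> nat \<Rightarrow> real" where
  "dyadic_hi n j = real j / 2 ^ (n - 1)"

lemma dyadic_less: "dyadic_lo n j < dyadic_hi n j"
  by (simp add: dyadic_lo_def dyadic_hi_def divide_strict_right_mono)

lemma dyadic_bounds:
  assumes "j \<in> {1..2 ^ (n - 1)}"
  shows "0 \<le> dyadic_lo n j" "dyadic_hi n j \<le> 1"
proof -
  have "real j \<le> 2 ^ (n - 1)"
    using assms by (metis atLeastAtMost_iff of_nat_le_iff of_nat_numeral of_nat_power)
  then show "0 \<le> dyadic_lo n j" "dyadic_hi n j \<le> 1"
    using assms by (simp_all add: dyadic_lo_def dyadic_hi_def)
qed

lemma D_arc_iff: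
  assumes "n \<ge> 1"
  shows "(x, y) \<in> D_arc n j \<longleftrightarrow> x \<in> {dyadic_lo n j..dyadic_hi n j} \<and>
    y = sqrt ((x - dyadic_lo n j) * (dyadic_hi n j - x))"
proof -
  obtain m where n: "n = Suc m"
    using assms by (cases n) auto
  have "(2 * real j - 1) / 2 ^ n = (dyadic_lo n j + dyadic_hi n j) / 2"
    "1 / 2 ^ n = (dyadic_hi n j - dyadic_lo n j) / 2"
    by (simp_all add: n dyadic_lo_def dyadic_hi_def field_simps)
  then show ?thesis
    using semicircle_iff [OF dyadic_less [of n j], of x y] by (simp only: D_arc_def mem_Collect_eq prod.case)
qed

text \<open>Overlapping dyadic intervals are nested, and off the line the semicircle over a proper
  subinterval lies strictly below the larger one.\<close>

lemma D_arc_unique_aux: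
  assumes arcs: "(x, y) \<in> D_arc n j" "(x, y) \<in> D_arc m k" and "y > 0" "1 \<le> n" "n \<le> m"
  shows "dyadic_lo n j = dyadic_lo m k \<and> dyadic_hi n j = dyadic_hi m k"
proof -
  have pos: "0 < (x - dyadic_lo i l) * (dyadic_hi i l - x)"
      "(x - dyadic_lo i l) * (dyadic_hi i l - x) = y\<^sup>2"
      "dyadic_lo i l < x" "x < dyadic_hi i l"
    if "(x, y) \<in> D_arc i l" "i \<ge> 1" for i l
  proof -
    have x: "dyadic_lo i l \<le> x" "x \<le> dyadic_hi i l" and y: "y = sqrt ((x - dyadic_lo i l) * (dyadic_hi i l - x))"
      using that D_arc_iff by auto
    then show 1: "0 < (x - dyadic_lo i l) * (dyadic_hi i l - x)"
      using \<open>y > 0\<close> by simp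
    then show "(x - dyadic_lo i l) * (dyadic_hi i l - x) = y\<^sup>2"
      using y by simp
    show "dyadic_lo i l < x" "x < dyadic_hi i l"
      using 1 x by (auto simp: zero_less_mult_iff)
  qed
  (* scaling by 2 ^ (m - 1) makes all four endpoints integers, so strict inequalities gain 1 *)
  define q :: nat where "q = 2 ^ (m - n)"
  have M: "(2::real) ^ (m - 1) = 2 ^ (n - 1) * real q"
    using assms by (simp add: q_def flip: power_add)
  have xn: "real j - 1 < x * 2 ^ (n - 1)" "x * 2 ^ (n - 1) < real j"
    using pos(3,4) [OF arcs(1)] assms by (simp_all add: dyadic_lo_def dyadic_hi_def field_simps)
  have xm: "real k - 1 < x * 2 ^ (m - 1)" "x * 2 ^ (m - 1) < real k"
    using pos(3,4) [OF arcs(2)] assms by (simp_all add: dyadic_lo_def dyadic_hi_def field_simps)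
  have q: "0 < real q"
    by (simp add: q_def)
  have "(real j - 1) * real q < x * 2 ^ (m - 1)" "x * 2 ^ (m - 1) < real j * real q"
    using mult_strict_right_mono [OF xn(1) q] mult_strict_right_mono [OF xn(2) q] by (simp_all only: M mult.assoc)
  with xm have "(real j - 1) * real q < real k" "real k - 1 < real j * real q"
    by linarith+
  then have "real_of_int ((int j - 1) * int q) < real_of_int (int k)"
      "real_of_int (int k - 1) < real_of_int (int j * int q)"
    by simp_all
  then have "(int j - 1) * int q \<le> int k - 1" "int k \<le> int j * int q"
    by (simp_all only: of_int_less_iff)
  then have "real_of_int ((int j - 1) * int q) \<le> real_of_int (int k - 1)"
      "real_of_int (int k) \<le> real_of_int (int j * int q)"
    by (simp_all only: of_int_le_iff)
  then have kj: "(real j - 1) * real q \<le> real k - 1" "real k \<le> real j * real q"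
    by simp_all
  have "dyadic_lo n j = (real j - 1) * real q / 2 ^ (m - 1)" "dyadic_hi n j = real j * real q / 2 ^ (m - 1)"
    unfolding dyadic_lo_def dyadic_hi_def M using q by simp_all
  then have nested: "dyadic_lo n j \<le> dyadic_lo m k" "dyadic_hi m k \<le> dyadic_hi n j"
    using kj by (simp_all only: dyadic_lo_def [of m] dyadic_hi_def [of m]) (intro divide_right_mono; simp)+
  have prod: "(x - dyadic_lo n j) * (dyadic_hi n j - x) = (x - dyadic_lo m k) * (dyadic_hi m k - x)"
    using pos(2) [OF arcs(1)] pos(2) [OF arcs(2)] assms by simp
  have "\<not> dyadic_lo n j < dyadic_lo m k"
  proof
    assume "dyadic_lo n j < dyadic_lo m k"
    then have "(x - dyadic_lo m k) * (dyadic_hi m k - x) < (x - dyadic_lo n j) * (dyadic_hi n j - x)"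
      using nested pos(3,4) [OF arcs(2)] assms by (intro mult_less_le_imp_less) auto
    with prod show False by simp
  qed
  moreover have "\<not> dyadic_hi m k < dyadic_hi n j"
  proof
    assume "dyadic_hi m k < dyadic_hi n j"
    then have "(x - dyadic_lo m k) * (dyadic_hi m k - x) < (x - dyadic_lo n j) * (dyadic_hi n j - x)"
      using nested pos(3,4) [OF arcs(2)] assms by (intro mult_le_less_imp_less) auto
    with prod show False by simp
  qed
  ultimately show ?thesis
    using nested by simp
qed

lemma D_arc_unique:
  assumes "(x, y) \<in> D_arc n j" "(x, y) \<in> D_arc m k" "y > 0" "1 \<le> n" "1 \<le> m"
  shows "dyadic_lo n j = dyadic_lo m k" "dyadic_hi n j = dyadic_hi m k"
  using D_arc_unique_aux [of x y n j m k] D_arc_unique_aux [of x y m k n j] assms by linarith+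

definition gaps_within :: "real \<Rightarrow> real \<Rightarrow> (real \<times> real) set" where
  "gaps_within u v = {I. u \<le> fst I \<and> snd I \<le> v}"

text \<open>This map preserves the first coordinate. It is the identity on the line, and it sends the
  semicircle over a dyadic interval to the arc that takes the semicircles over just those gaps
  that lie in the interval. The condition \<open>snd z > 0\<close> makes the former hold by definition.\<close>

definition D_to_W :: "real \<times> real \<Rightarrow> real \<times> real" where
  "D_to_W z = gap_arches {I. snd z > 0 \<and> (\<exists>n\<ge>1. \<exists>j\<in>{1..2 ^ (n - 1)}. z \<in> D_arc n j \<and>
      I \<in> gaps_within (dyadic_lo n j) (dyadic_hi n j))} (fst z)"

lemma fst_D_to_W [simp]: "fst (D_to_W z) = fst z"
  by (simp add: D_to_W_def gap_arches_def)

lemma D_to_W_line: "D_to_W (x, 0) = lambda_inf x"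
  by (simp add: D_to_W_def lambda_inf_eq)

lemma D_to_W_arc:
  assumes "n \<ge> 1" "j \<in> {1..2 ^ (n - 1)}" "z \<in> D_arc n j"
  shows "D_to_W z = gap_arches (gaps_within (dyadic_lo n j) (dyadic_hi n j)) (fst z)"
proof -
  obtain x y where z: "z = (x, y)" by fastforce
  have x: "x \<in> {dyadic_lo n j..dyadic_hi n j}" and y: "y = sqrt ((x - dyadic_lo n j) * (dyadic_hi n j - x))"
    using assms z D_arc_iff by auto
  have "y \<ge> 0"
    using x y by simp
  then consider "y > 0" | "y = 0" by linarith
  then show ?thesis
  proof cases
    case 1
    have "gaps_within (dyadic_lo m k) (dyadic_hi m k) = gaps_within (dyadic_lo n j) (dyadic_hi n j)"
      if "m \<ge> 1" "z \<in> D_arc m k" for m k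
      using D_arc_unique [of x y m k n j] that assms 1 by (simp add: z)
    moreover have "snd z > 0"
      using 1 z by simp
    ultimately have "{I. snd z > 0 \<and> (\<exists>m\<ge>1. \<exists>k\<in>{1..2 ^ (m - 1)}. z \<in> D_arc m k \<and>
      I \<in> gaps_within (dyadic_lo m k) (dyadic_hi m k))} = gaps_within (dyadic_lo n j) (dyadic_hi n j)"
      using assms by (intro equalityI subsetI CollectI conjI) (blast, assumption, blast)
    then show ?thesis
      by (simp add: D_to_W_def)
  next
    case 2
    then have "x = dyadic_lo n j \<or> x = dyadic_hi n j"
      using y by auto
    then have "gap_height {} x = gap_height (gaps_within (dyadic_lo n j) (dyadic_hi n j)) x"
      using x dyadic_bounds [OF assms(2)] by (intro gap_height_cong) (auto simp: gaps_within_def)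
    then show ?thesis
      using 2 by (simp add: z D_to_W_line lambda_inf_eq gap_arches_def)
  qed
qed

lemma D_space_cases:
  assumes "z \<in> D_space"
  obtains x where "x \<in> {0..1}" "z = (x, 0)"
  | n j where "n \<ge> 1" "j \<in> {1..2 ^ (n - 1)}" "z \<in> D_arc n j"
  using assms by (auto simp: D_space_def)

lemma D_arc_bounds:
  assumes "n \<ge> 1" "j \<in> {1..2 ^ (n - 1)}" "z \<in> D_arc n j"
  shows "fst z \<in> {0..1}" "0 \<le> snd z" "snd z \<le> 1 / 2 ^ n"
proof -
  show "fst z \<in> {0..1}"
    using assms D_arc_iff [OF assms(1), of "fst z" "snd z" j] dyadic_bounds [OF assms(2)] by auto
  have sq: "(fst z - (2 * real j - 1) / 2 ^ n)\<^sup>2 + (snd z)\<^sup>2 = (1 / 2 ^ n)\<^sup>2" and "0 \<le> snd z"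
    using assms(3) by (auto simp: D_arc_def)
  have "(snd z)\<^sup>2 \<le> (1 / 2 ^ n)\<^sup>2"
    unfolding sq [symmetric] by simp
  then show "0 \<le> snd z" "snd z \<le> 1 / 2 ^ n"
    using power2_le_imp_le [of "snd z" "1 / 2 ^ n"] \<open>0 \<le> snd z\<close> by simp_all
qed

lemma D_space_bounds:
  assumes "z \<in> D_space"
  shows "fst z \<in> {0..1}" "0 \<le> snd z"
proof -
  have "fst z \<in> {0..1} \<and> 0 \<le> snd z"
    using assms
  proof (cases rule: D_space_cases)
    case (2 n j)
    then show ?thesis
      using D_arc_bounds by blast
  qed auto
  then show "fst z \<in> {0..1}" "0 \<le> snd z"
    by auto
qed

lemma D_to_W_in_W: "z \<in> D_space \<Longrightarrow> D_to_W z \<in> W_space"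
  unfolding D_to_W_def by (intro gap_arches_in_W D_space_bounds)

text \<open>The semicircle over a gap does not rise above the one over an interval that contains the gap.\<close>

lemma D_to_W_height:
  assumes "z \<in> D_space"
  shows "0 \<le> snd (D_to_W z)" "snd (D_to_W z) \<le> snd z"
proof -
  have "0 \<le> snd (D_to_W z) \<and> snd (D_to_W z) \<le> snd z"
    using assms
  proof (cases rule: D_space_cases)
    case (1 x)
    then show ?thesis
      by (simp add: D_to_W_line lambda_inf_def)
  next
    case (2 n j)
    let ?u = "dyadic_lo n j" and ?v = "dyadic_hi n j" and ?x = "fst z"
    have x: "?x \<in> {?u..?v}" "?x \<in> {0..1}" and z: "snd z = sqrt ((?x - ?u) * (?v - ?x))"
      using 2 D_arc_iff [of n "fst z" "snd z" j] D_arc_bounds by auto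
    have "0 \<le> gap_height (gaps_within ?u ?v) ?x \<and> gap_height (gaps_within ?u ?v) ?x \<le> snd z"
    proof (cases "?x \<notin> cantor_set \<and> gap_of ?x \<in> gaps_within ?u ?v")
      case True
      let ?a = "fst (gap_of ?x)" and ?b = "snd (gap_of ?x)"
      have "?u \<le> ?a" "?a < ?x" "?x < ?b" "?b \<le> ?v"
        using gap_of [OF x(2)] True by (auto simp: gaps_within_def)
      then have "0 \<le> (?x - ?a) * (?b - ?x)" "(?x - ?a) * (?b - ?x) \<le> (?x - ?u) * (?v - ?x)"
        by (auto intro!: mult_mono)
      with True z show ?thesis
        by (simp add: gap_height_def)
    next
      case False
      with z x show ?thesis
        by (auto simp: gap_height_def)
    qed
    then show ?thesis
      by (simp add: D_to_W_arc [OF 2] gap_arches_def)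
  qed
  then show "0 \<le> snd (D_to_W z)" "snd (D_to_W z) \<le> snd z"
    by auto
qed

lemma closed_D_arc: "closed (D_arc n j)"
proof -
  have "D_arc n j = {z. (fst z - (2 * real j - 1) / 2 ^ n)\<^sup>2 + (snd z)\<^sup>2 = (1 / 2 ^ n)\<^sup>2} \<inter> {z. 0 \<le> snd z}"
    by (auto simp: D_arc_def)
  then show ?thesis
    by (auto intro!: closed_Int closed_Collect_eq closed_Collect_le continuous_intros)
qed

text \<open>Near a point of the line, the height of the image is squeezed by that of its argument. Off the
  line only finitely many semicircles come close, and the map is continuous on each.\<close>

lemma continuous_on_D_to_W: "continuous_on D_space D_to_W"
  unfolding continuous_on_eq_continuous_within
proof
  fix z0 assume z0: "z0 \<in> D_space"
  show "continuous (at z0 within D_space) D_to_W"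
  proof (cases "snd z0 = 0")
    case True
    have in_D: "\<forall>\<^sub>F z in at z0 within D_space. z \<in> D_space"
      by (simp add: eventually_at_filter)
    have "((\<lambda>z. (fst z, snd (D_to_W z))) \<longlongrightarrow> (fst z0, 0)) (at z0 within D_space)"
    proof (rule tendsto_Pair)
      show "(fst \<longlongrightarrow> fst z0) (at z0 within D_space)"
        by (intro tendsto_intros)
      show "((\<lambda>z. snd (D_to_W z)) \<longlongrightarrow> 0) (at z0 within D_space)"
      proof (rule tendsto_sandwich)
        show "\<forall>\<^sub>F z in at z0 within D_space. 0 \<le> snd (D_to_W z)"
          "\<forall>\<^sub>F z in at z0 within D_space. snd (D_to_W z) \<le> snd z"
          by (rule eventually_mono [OF in_D], erule D_to_W_height)+
        show "((\<lambda>z. snd z) \<longlongrightarrow> 0) (at z0 within D_space)"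
          using tendsto_snd [OF tendsto_ident_at, of z0 D_space] True by simp
      qed simp
    qed
    moreover have "(\<lambda>z. (fst z, snd (D_to_W z))) = D_to_W"
      by (simp add: fun_eq_iff prod_eq_iff)
    moreover have "D_to_W z0 = (fst z0, 0)"
      using True by (cases z0) (simp add: D_to_W_line lambda_inf_def)
    ultimately show ?thesis
      by (simp add: continuous_within)
  next
    case False
    then have y0: "0 < snd z0"
      using D_space_bounds(2) [OF z0] by simp
    (* the arcs with n > N stay below half the height of z0 *)
    obtain N where N: "(1 / 2) ^ N < snd z0 / 2"
      using real_arch_pow_inv [of "snd z0 / 2" "1/2"] y0 by auto
    let ?I = "SIGMA n : {1..N}. {1..2 ^ (n - 1)}"
    let ?K = "\<Union>(n, j)\<in>?I. D_arc n j"
    let ?U = "{z :: real \<times> real. snd z0 / 2 < snd z}"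
    have "continuous_on (D_arc n j) D_to_W" if "(n, j) \<in> ?I" for n j
    proof -
      have nj: "n \<ge> 1" "j \<in> {1..2 ^ (n - 1)}"
        using that by auto
      have "continuous_on (D_arc n j) (\<lambda>z. gap_arches (gaps_within (dyadic_lo n j) (dyadic_hi n j)) (fst z))"
        using D_arc_bounds [OF nj]
        by (intro continuous_on_compose2 [OF continuous_on_gap_arches] continuous_intros) auto
      then show ?thesis
        using D_to_W_arc [OF nj] by (subst continuous_on_cong [OF refl]) auto
    qed
    then have "continuous_on ?K D_to_W"
      by (intro continuous_on_closed_Union) (auto simp: closed_D_arc)
    moreover have eq: "D_space \<inter> ?U = ?K \<inter> ?U"
    proof
      show "D_space \<inter> ?U \<subseteq> ?K \<inter> ?U"
      proof clarify
        fix x y assume D: "(x, y) \<in> D_space" and U: "snd z0 / 2 < snd (x, y)"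
        from D show "(x, y) \<in> ?K \<inter> ?U"
        proof (cases rule: D_space_cases)
          case (2 n j)
          have "(1 / 2) ^ N < (1 / 2 :: real) ^ n"
            using D_arc_bounds(3) [OF 2] N U by (simp add: power_one_over)
          then have "n \<le> N"
            using power_decreasing [of N n "1 / 2 :: real"] by (cases "n \<le> N") auto
          then have "(n, j) \<in> ?I"
            using 2 by simp
          then have "(x, y) \<in> ?K"
            using 2(3) by (intro UN_I [of "(n, j)"]) auto
          with U show ?thesis by simp
        qed (use U y0 in auto)
      qed
      show "?K \<inter> ?U \<subseteq> D_space \<inter> ?U"
        by (auto simp: D_space_def)
    qed
    moreover have "z0 \<in> ?U"
      using y0 by simp
    moreover have "open ?U"
      by (intro open_Collect_less continuous_intros)
    ultimately have "continuous (at z0 within ?K) D_to_W" "at z0 within D_space = at z0 within ?K"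
      using z0 by (force simp: continuous_on_eq_continuous_within, intro at_within_nhd [of _ ?U]) auto
    then show ?thesis
      by simp
  qed
qed

lemma D_path_in_arc:
  assumes "n \<ge> 1" "t \<in> {0..1}"
  shows "D_path n j t \<in> D_arc n j"
proof -
  let ?N = "(2::real) ^ (n - 1)" and ?x = "(t + real j - 1) / 2 ^ (n - 1)"
  have x: "?x - dyadic_lo n j = t / ?N" "dyadic_hi n j - ?x = (1 - t) / ?N"
    by (simp_all add: dyadic_lo_def dyadic_hi_def flip: diff_divide_distrib)
  have "0 \<le> ?x - dyadic_lo n j" "0 \<le> dyadic_hi n j - ?x"
    unfolding x using assms(2) by simp_all
  then have mem: "?x \<in> {dyadic_lo n j..dyadic_hi n j}"
    by simp
  have "t / ?N * ((1 - t) / ?N) = (t - t\<^sup>2) / ?N\<^sup>2"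
    by (simp add: power2_eq_square algebra_simps)
  then have "1 / ?N * sqrt (t - t\<^sup>2) = sqrt (t / ?N * ((1 - t) / ?N))"
    by (simp add: real_sqrt_divide)
  with mem show ?thesis
    unfolding D_path_def D_arc_iff [OF assms(1)] x by (intro conjI)
qed

lemma path_in_D_path:
  assumes "n \<ge> 1" "j \<in> {1..2 ^ (n - 1)}"
  shows "path_in D_space (D_path n j)"
  unfolding path_in_iff
proof
  show "continuous_on {0..1} (D_path n j)"
    unfolding D_path_def by (intro continuous_intros) auto
  show "\<forall>t\<in>{0..1}. D_path n j t \<in> D_space"
    using D_path_in_arc [OF assms(1)] assms unfolding D_space_def by blast
qed

lemma fst_D_path: "fst (D_path n j t) = linepath (dyadic_lo n j) (dyadic_hi n j) t"
  by (simp add: D_path_def linepath_def dyadic_lo_def dyadic_hi_def add_divide_distrib diff_divide_distrib algebra_simps)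

lemma D_path_ends:
  "pathstart (D_path n j) = (dyadic_lo n j, 0)" "pathfinish (D_path n j) = (dyadic_hi n j, 0)"
  by (simp_all add: D_path_def pathstart_def pathfinish_def dyadic_lo_def dyadic_hi_def)

lemma gap_arches_within: "0 \<le> u \<Longrightarrow> u \<le> 1 \<Longrightarrow> gap_arches (gaps_within 0 u) u = (u, 0)"
  using gap_of [of u] by (auto simp: gap_arches_def gap_height_def gaps_within_def)

lemma D_to_W_D_path:
  assumes "n \<ge> 1" "j \<in> {1..2 ^ (n - 1)}" "t \<in> {0..1}"
  shows "D_to_W (D_path n j t) =
    seg (gap_arches (gaps_within (dyadic_lo n j) (dyadic_hi n j))) (dyadic_lo n j) (dyadic_hi n j) t"
  using D_to_W_arc [OF assms(1,2) D_path_in_arc [OF assms(1,3)]] by (simp add: seg_def fst_D_path)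

context pi1_subgroup
begin

context
  fixes f :: "real \<times> real \<Rightarrow> 'a"
  assumes f: "continuous_on W_space f" "f ` W_space \<subseteq> X" "f d0 = x0"
    and W: "induced_map X f ` W_subgroup \<subseteq> H"
begin

abbreviation \<Gamma> :: "(real \<times> real) set \<Rightarrow> real \<Rightarrow> 'a" where
  "\<Gamma> S \<equiv> f \<circ> gap_arches S"

lemma \<Gamma>: "path_in X (\<Gamma> S)" "\<Gamma> S 0 = x0"
  using f by (auto intro!: path_in_continuous_image path_in_gap_arches)

lemma seg_\<Gamma>_cong:
  assumes uv: "0 \<le> u" "u \<le> v" "v \<le> 1" and t: "t \<in> {0..1}"
    and eq: "\<And>I. I \<in> cantor_gaps \<Longrightarrow> fst I < v \<Longrightarrow> u < snd I \<Longrightarrow> I \<in> S \<longleftrightarrow> I \<in> T"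
  shows "seg (\<Gamma> S) u v t = seg (\<Gamma> T) u v t"
proof -
  have "linepath u v t \<in> {u..v}"
    using linepath_in_path [OF t, of u v] uv by (simp add: closed_segment_eq_real_ivl)
  then have "gap_height S (linepath u v t) = gap_height T (linepath u v t)"
    using uv by (intro gap_height_cong eq) auto
  then show ?thesis
    by (simp add: seg_def gap_arches_def)
qed

text \<open>Up to \<open>b\<close> the arc agrees with \<open>upsilon_inf\<close>, so leaving out the semicircle over \<open>(a, b)\<close> costs
  just one generator of \<open>W_subgroup\<close>.\<close>

lemma coset_eq_remove_gap:
  assumes I: "(a, b) \<in> cantor_gaps" and v: "b \<le> v" "v \<le> 1"
    and S: "\<And>J. J \<in> cantor_gaps \<Longrightarrow> snd J \<le> b \<Longrightarrow> J \<in> S"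
  shows "seg (\<Gamma> S) 0 v \<doteq> seg (\<Gamma> (S - {(a, b)})) 0 v"
proof -
  let ?T = "S - {(a, b)}"
  have ab: "a < b" "0 \<le> a" "a \<in> {0..1}" "b \<in> {0..1}" "v \<in> {0..1}" "a \<in> cantor_set" "b \<in> cantor_set"
    using cantor_gapD [OF I] v by auto
  have below: "snd J \<le> a" if "J \<in> cantor_gaps" "fst J < a" for J
    using cantor_set_outside_gap [OF that(1) ab(6)] that by auto
  have above: "b \<le> fst J" if "J \<in> cantor_gaps" "b < snd J" for J
    using cantor_set_outside_gap [OF that(1) ab(7)] that by auto
  have same: "J = (a, b)" if "J \<in> cantor_gaps" "fst J < b" "a < snd J" for J
    using cantor_gaps_disjoint [OF that(1) I] that by auto
  have \<Gamma>_eq: "\<Gamma> S' c = \<Gamma> T' c" if "c \<in> cantor_set" for S' T' c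
    using gap_arches_cantor [OF that, of S' T'] by simp
  have "induced_map X f (W_generator (a, b)) \<in> H"
    using W I by (auto simp: W_subgroup_def intro: generate.incl)
  then have gen: "seg (\<Gamma> UNIV) 0 b \<doteq> seg (\<Gamma> UNIV) 0 a +++ seg (\<Gamma> {}) a b"
    using W_generator_in_H_iff [OF f I] by (simp add: upsilon_inf_eq lambda_inf_eq)
  have "seg (\<Gamma> S) 0 b \<doteq> seg (\<Gamma> ?T) 0 a +++ seg (\<Gamma> ?T) a b"
  proof (rule coset_eq_cong [OF gen])
    fix t :: real assume t: "t \<in> {0..1}"
    show "seg (\<Gamma> UNIV) 0 b t = seg (\<Gamma> S) 0 b t"
    proof (rule seg_\<Gamma>_cong [OF _ _ _ t])
      show "J \<in> UNIV \<longleftrightarrow> J \<in> S" if "J \<in> cantor_gaps" "fst J < b" "0 < snd J" for J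
        using S [OF that(1)] above [OF that(1)] that by fastforce
    qed (use ab in auto)
    have "seg (\<Gamma> UNIV) 0 a s = seg (\<Gamma> ?T) 0 a s" if "s \<in> {0..1}" for s
    proof (rule seg_\<Gamma>_cong [OF _ _ _ that])
      show "J \<in> UNIV \<longleftrightarrow> J \<in> ?T" if "J \<in> cantor_gaps" "fst J < a" "0 < snd J" for J
        using S [OF that(1)] below [OF that(1)] that ab by auto
    qed (use ab in auto)
    moreover have "seg (\<Gamma> {}) a b s = seg (\<Gamma> ?T) a b s" if "s \<in> {0..1}" for s
    proof (rule seg_\<Gamma>_cong [OF _ _ _ that])
      show "J \<in> {} \<longleftrightarrow> J \<in> ?T" if "J \<in> cantor_gaps" "fst J < b" "a < snd J" for J
        using same [OF that] by simp
    qed (use ab in auto)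
    ultimately show "(seg (\<Gamma> UNIV) 0 a +++ seg (\<Gamma> {}) a b) t = (seg (\<Gamma> ?T) 0 a +++ seg (\<Gamma> ?T) a b) t"
      using t by (simp add: joinpaths_def)
  qed
  then have upper: "seg (\<Gamma> S) 0 b +++ seg (\<Gamma> S) b v \<doteq> (seg (\<Gamma> ?T) 0 a +++ seg (\<Gamma> ?T) a b) +++ seg (\<Gamma> S) b v"
    using \<Gamma> ab by (intro coset_eq_join) auto
  have upper_eq: "seg (\<Gamma> S) b v t = seg (\<Gamma> ?T) b v t" if "t \<in> {0..1}" for t
  proof (rule seg_\<Gamma>_cong [OF _ _ _ that])
    show "J \<in> S \<longleftrightarrow> J \<in> ?T" if "J \<in> cantor_gaps" "fst J < v" "b < snd J" for J
      using that by auto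
  qed (use ab v in auto)
  have "seg (\<Gamma> S) 0 b +++ seg (\<Gamma> S) b v \<doteq> (seg (\<Gamma> ?T) 0 a +++ seg (\<Gamma> ?T) a b) +++ seg (\<Gamma> ?T) b v"
    by (rule coset_eq_cong [OF upper]) (simp_all add: joinpaths_def upper_eq)
  moreover have "seg (\<Gamma> S) 0 b +++ seg (\<Gamma> S) b v \<doteq> seg (\<Gamma> S) 0 v"
    using ab \<Gamma> [of S] by (intro coset_eq_homotopic homotopic_paths_seg_join) auto
  moreover have "(seg (\<Gamma> ?T) 0 a +++ seg (\<Gamma> ?T) a b) +++ seg (\<Gamma> ?T) b v \<doteq> seg (\<Gamma> ?T) 0 v"
  proof -
    have "(seg (\<Gamma> ?T) 0 a +++ seg (\<Gamma> ?T) a b) +++ seg (\<Gamma> ?T) b v \<doteq> seg (\<Gamma> ?T) 0 b +++ seg (\<Gamma> ?T) b v"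
      using ab \<Gamma> [of ?T] by (intro coset_eq_join coset_eq_homotopic homotopic_paths_seg_join) auto
    also have "\<dots> \<doteq> seg (\<Gamma> ?T) 0 v"
      using ab \<Gamma> [of ?T] by (intro coset_eq_homotopic homotopic_paths_seg_join) auto
    finally show ?thesis .
  qed
  ultimately show ?thesis
    using coset_eq_sym coset_eq_trans by blast
qed

text \<open>A reference path to each point of the line, against which images of standard paths are
  compared. It takes the semicircles over all gaps to the left of \<open>u\<close>, but stays on the line over
  a gap that contains \<open>u\<close>.\<close>

definition \<Lambda> :: "real \<Rightarrow> real \<Rightarrow> 'a" where
  "\<Lambda> u = seg (\<Gamma> (gaps_within 0 u)) 0 u"

lemma \<Lambda>: "u \<in> {0..1} \<Longrightarrow> path_in X (\<Lambda> u)" "pathstart (\<Lambda> u) = x0"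
  "u \<in> {0..1} \<Longrightarrow> pathfinish (\<Lambda> u) = f (u, 0)"
  using \<Gamma> by (auto simp: \<Lambda>_def gap_arches_within)

text \<open>Both sides take the semicircle over the same gaps, with one possible exception: the gap around
  \<open>u\<close>, if it ends no later than \<open>v\<close>.\<close>

lemma \<Lambda>_extend:
  assumes uv: "0 \<le> u" "u \<le> v" "v \<le> 1"
  shows "\<Lambda> u +++ seg (\<Gamma> (gaps_within u v)) u v \<doteq> \<Lambda> v"
proof -
  define T where "T = gaps_within 0 u \<union> gaps_within u v"
  have 01: "u \<in> {0..1}" "v \<in> {0..1}"
    using uv by auto
  have T1: "seg (\<Gamma> T) 0 u t = \<Lambda> u t" if "t \<in> {0..1}" for t
    unfolding \<Lambda>_def
  proof (rule seg_\<Gamma>_cong [OF _ _ _ that])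
    show "J \<in> T \<longleftrightarrow> J \<in> gaps_within 0 u" if "J \<in> cantor_gaps" "fst J < u" "0 < snd J" for J
      using that by (auto simp: T_def gaps_within_def)
  qed (use uv in auto)
  have T2: "seg (\<Gamma> T) u v t = seg (\<Gamma> (gaps_within u v)) u v t" if "t \<in> {0..1}" for t
  proof (rule seg_\<Gamma>_cong [OF _ _ _ that])
    show "J \<in> T \<longleftrightarrow> J \<in> gaps_within u v" if "J \<in> cantor_gaps" "fst J < v" "u < snd J" for J
      using that by (auto simp: T_def gaps_within_def)
  qed (use uv in auto)
  have "seg (\<Gamma> T) 0 u +++ seg (\<Gamma> T) u v \<doteq> seg (\<Gamma> T) 0 v"
    using 01 \<Gamma> [of T] by (intro coset_eq_homotopic homotopic_paths_seg_join) auto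
  then have 1: "\<Lambda> u +++ seg (\<Gamma> (gaps_within u v)) u v \<doteq> seg (\<Gamma> T) 0 v"
    by (rule coset_eq_cong) (use T1 T2 in \<open>auto simp: joinpaths_def\<close>)
  have "\<Lambda> v \<doteq> seg (\<Gamma> T) 0 v"
  proof (cases "\<exists>a b. (a, b) \<in> cantor_gaps \<and> a < u \<and> u < b \<and> b \<le> v")
    case False
    have "\<Lambda> v \<doteq> \<Lambda> v"
      using \<Lambda> 01 by (intro coset_eq_refl) auto
    then show ?thesis
    proof (rule coset_eq_cong)
      show "\<Lambda> v t = seg (\<Gamma> T) 0 v t" if "t \<in> {0..1}" for t
        unfolding \<Lambda>_def
      proof (rule seg_\<Gamma>_cong [OF _ _ _ that])
        show "J \<in> gaps_within 0 v \<longleftrightarrow> J \<in> T" if J: "J \<in> cantor_gaps" for J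
        proof -
          have "\<not> (fst J < u \<and> u < snd J \<and> snd J \<le> v)"
            using False J by (metis prod.collapse)
          then have "snd J \<le> v \<Longrightarrow> snd J \<le> u \<or> u \<le> fst J"
            by linarith
          then show ?thesis
            using cantor_gapD [OF J] uv by (auto simp: T_def gaps_within_def)
        qed
      qed (use uv in auto)
    qed simp
  next
    case True
    then obtain a b where I: "(a, b) \<in> cantor_gaps" and ab: "a < u" "u < b" "b \<le> v"
      by blast
    have "\<Lambda> v \<doteq> seg (\<Gamma> (gaps_within 0 v - {(a, b)})) 0 v"
      unfolding \<Lambda>_def
    proof (rule coset_eq_remove_gap [OF I ab(3) uv(3)])
      show "J \<in> gaps_within 0 v" if "J \<in> cantor_gaps" "snd J \<le> b" for J
        using cantor_gapD [OF that(1)] that ab by (auto simp: gaps_within_def)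
    qed
    then show ?thesis
    proof (rule coset_eq_cong)
      show "seg (\<Gamma> (gaps_within 0 v - {(a, b)})) 0 v t = seg (\<Gamma> T) 0 v t" if "t \<in> {0..1}" for t
      proof (rule seg_\<Gamma>_cong [OF _ _ _ that])
        show "J \<in> gaps_within 0 v - {(a, b)} \<longleftrightarrow> J \<in> T" if J: "J \<in> cantor_gaps" for J
        proof -
          have "J = (a, b) \<or> snd J \<le> u \<or> u \<le> fst J"
            using cantor_gaps_disjoint [OF J I] ab by force
          then show ?thesis
            using cantor_gapD [OF J] uv ab by (auto simp: T_def gaps_within_def)
        qed
      qed (use uv in auto)
    qed simp
  qed
  with 1 show ?thesis
    using coset_eq_sym coset_eq_trans by blast
qed

lemma f_D_to_W: "continuous_on D_space (f \<circ> D_to_W)" "(f \<circ> D_to_W) ` D_space \<subseteq> X"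
proof -
  have "D_to_W ` D_space \<subseteq> W_space"
    using D_to_W_in_W by blast
  then show "continuous_on D_space (f \<circ> D_to_W)" "(f \<circ> D_to_W) ` D_space \<subseteq> X"
    using f by (auto intro: continuous_on_compose continuous_on_D_to_W continuous_on_subset simp del: o_apply)
       (auto simp: image_subset_iff)
qed

lemma path_in_f_D: "path_in D_space q \<Longrightarrow> path_in X ((f \<circ> D_to_W) \<circ> q)"
  by (rule path_in_continuous_image [OF _ f_D_to_W])

text \<open>The reference paths telescope along a concatenation.\<close>

lemma standard_concat_coset:
  assumes "standard_concat q"
  shows "path_in D_space q \<and> snd (pathstart q) = 0 \<and> snd (pathfinish q) = 0 \<and>
    \<Lambda> (fst (pathstart q)) +++ ((f \<circ> D_to_W) \<circ> q) \<doteq> \<Lambda> (fst (pathfinish q))"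
  using assms
proof induction
  case (single p)
  then obtain n j where nj: "n \<ge> 1" "j \<in> {1..2 ^ (n - 1)}"
    and p: "p = D_path n j \<or> p = reversepath (D_path n j)"
    by (auto simp: standard_path_def)
  let ?u = "dyadic_lo n j" and ?v = "dyadic_hi n j" and ?q = "(f \<circ> D_to_W) \<circ> D_path n j"
  have uv: "0 \<le> ?u" "?u \<le> ?v" "?v \<le> 1"
    using dyadic_bounds [OF nj(2)] dyadic_less [of n j] by auto
  have step: "\<Lambda> ?u +++ ?q \<doteq> \<Lambda> ?v"
    by (rule coset_eq_cong [OF \<Lambda>_extend [OF uv]])
       (auto simp: joinpaths_def D_to_W_D_path [OF nj] simp flip: compose_seg)
  have q: "path_in X ?q" "pathstart ?q = f (?u, 0)" "pathfinish ?q = f (?v, 0)"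
    using path_in_f_D [OF path_in_D_path [OF nj]]
    by (auto simp: pathstart_compose pathfinish_compose D_path_ends D_to_W_line lambda_inf_def)
  from p show ?case
  proof
    assume p: "p = D_path n j"
    then show ?thesis
      using step path_in_D_path [OF nj] unfolding p D_path_ends fst_conv snd_conv by blast
  next
    assume p: "p = reversepath (D_path n j)"
    have "\<Lambda> ?v +++ reversepath ?q \<doteq> (\<Lambda> ?u +++ ?q) +++ reversepath ?q"
      using step uv q by (intro coset_eq_join [OF coset_eq_sym]) (auto simp: \<Lambda>)
    also have "\<dots> \<doteq> \<Lambda> ?u +++ (?q +++ reversepath ?q)"
      using uv q by (intro coset_eq_homotopic homotopic_paths_assoc') (auto simp: \<Lambda>)
    also have "\<dots> \<doteq> \<Lambda> ?u +++ (\<lambda>_. f (?u, 0))"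
      using uv q homotopic_paths_cancel_right [OF q(1)]
      by (intro coset_eq_homotopic homotopic_paths_join_right) (auto simp: \<Lambda>)
    also have "\<dots> \<doteq> \<Lambda> ?u"
      using uv by (intro coset_eq_homotopic homotopic_paths_join_const) (auto simp: \<Lambda>)
    finally have "\<Lambda> ?v +++ reversepath ?q \<doteq> \<Lambda> ?u" .
    moreover have "path_in D_space (reversepath (D_path n j))"
      using path_in_D_path [OF nj] by simp
    ultimately show ?thesis
      unfolding p pathstart_reversepath pathfinish_reversepath D_path_ends compose_reversepath fst_conv snd_conv
      by blast
  qed
next
  case (join p q)
  let ?p = "(f \<circ> D_to_W) \<circ> p" and ?q = "(f \<circ> D_to_W) \<circ> q"
  let ?u = "fst (pathstart p)" and ?v = "fst (pathfinish p)" and ?w = "fst (pathfinish q)"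
  have p: "path_in D_space p" "snd (pathstart p) = 0" "snd (pathfinish p) = 0" "\<Lambda> ?u +++ ?p \<doteq> \<Lambda> ?v"
    using join.IH(1) by blast+
  have q: "path_in D_space q" "snd (pathfinish q) = 0" "\<Lambda> ?v +++ ?q \<doteq> \<Lambda> ?w"
    using join.IH(2) unfolding join(3) by blast+
  have u: "?u \<in> {0..1}"
    using p(1) D_space_bounds(1) by (auto simp: path_in_iff pathstart_def)
  have v: "?v \<in> {0..1}"
    using p(1) D_space_bounds(1) by (auto simp: path_in_iff pathfinish_def)
  have line: "D_to_W z = z" if "snd z = 0" for z
    using that by (cases z) (simp add: D_to_W_line lambda_inf_def)
  have pq: "path_in X ?p" "path_in X ?q" "pathstart ?p = f (?u, 0)" "pathfinish ?p = f (?v, 0)" "pathstart ?q = f (?v, 0)"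
    using path_in_f_D p q join(3)
    by (auto simp: pathstart_compose pathfinish_compose line prod_eq_iff intro!: arg_cong [of _ _ f])
  have "\<Lambda> ?u +++ (?p +++ ?q) \<doteq> (\<Lambda> ?u +++ ?p) +++ ?q"
    using u pq by (intro coset_eq_sym [OF coset_eq_homotopic] homotopic_paths_assoc') (auto simp: \<Lambda>)
  also have "\<dots> \<doteq> \<Lambda> ?v +++ ?q"
    using p pq by (intro coset_eq_join) auto
  also have "\<dots> \<doteq> \<Lambda> ?w"
    by (rule q)
  finally have "\<Lambda> ?u +++ (?p +++ ?q) \<doteq> \<Lambda> ?w" .
  moreover have "path_in D_space (p +++ q)"
    using p q join(3) by simp
  moreover have "(f \<circ> D_to_W) \<circ> (p +++ q) = ?p +++ ?q"
    by (rule path_compose_join)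
  ultimately show ?case
    using p(2) q(2) by (simp only: pathstart_join pathfinish_join simp_thms)
qed

text \<open>All gaps lie in \<open>[0, 1]\<close>, so \<open>D_to_W\<close> turns \<open>lambda_one\<close> into \<open>upsilon_inf\<close>. For a loop at \<open>d0\<close> both
  reference paths are constant, and its image is in \<open>H\<close>.\<close>

lemma w_inf_in_H:
  assumes closed: "closed_wrt D_space d0 D_subgroup d_inf X x0 H"
  shows "induced_map X f w_inf \<in> H"
proof -
  let ?g = "f \<circ> D_to_W"
  have g: "continuous_on D_space ?g" "?g ` D_space \<subseteq> X"
    by (rule f_D_to_W)+
  have d0: "?g d0 = x0"
    using f by (simp add: d0_def D_to_W_line lambda_inf_def)
  have g_class: "induced_map X ?g (path_class D_space p) = path_class X (?g \<circ> p)" if "path_in D_space p" for p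
    using that g by (intro induced_map_path_class) (auto simp: path_in_def)
  have "induced_map X ?g ` D_subgroup \<subseteq> H"
  proof
    fix A assume "A \<in> induced_map X ?g ` D_subgroup"
    then obtain q where q: "standard_concat q" "pathstart q = d0" "pathfinish q = d0"
      and A: "A = induced_map X ?g (path_class D_space q)"
      by (auto simp: D_subgroup_def)
    note qq = standard_concat_coset [OF q(1)]
    have gq: "path_in X (?g \<circ> q)" "pathstart (?g \<circ> q) = x0" "pathfinish (?g \<circ> q) = x0"
      using path_in_f_D qq q d0 by (auto simp: pathstart_compose pathfinish_compose)
    have "\<Lambda> 0 = (\<lambda>_. x0)"
      using \<Gamma>(2) by (simp add: \<Lambda>_def)
    then have "(\<lambda>_. x0) +++ (?g \<circ> q) \<doteq> (\<lambda>_. x0)"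
      using qq q by (simp add: d0_def)
    moreover have "?g \<circ> q \<doteq> (\<lambda>_. x0) +++ (?g \<circ> q)"
      using gq base by (intro coset_eq_sym [OF coset_eq_homotopic] homotopic_paths_const_join) auto
    ultimately have "?g \<circ> q \<doteq> (\<lambda>_. x0)"
      using coset_eq_trans by blast
    then have "path_class X (?g \<circ> q) \<in> H"
      using coset_eq_const_iff gq by (simp add: loops_at_iff)
    then show "A \<in> H"
      using A g_class qq by simp
  qed
  then have "induced_map X ?g d_inf \<in> H"
    using closed g d0 unfolding closed_wrt_def by blast
  moreover have lambda: "path_in D_space lambda_one" "path_in D_space lambda_inf"
    using path_in_D_path [of 1 1] by (auto simp: lambda_one_def path_in_iff lambda_inf_def D_space_def intro!: continuous_intros)
  moreover have "pathstart lambda_one = (0, 0)" "pathfinish lambda_one = (1, 0)"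
    "pathstart lambda_inf = (0, 0)" "pathfinish lambda_inf = (1, 0)"
    using D_path_ends [of 1 1]
    by (simp_all add: lambda_one_def lambda_inf_def dyadic_lo_def dyadic_hi_def pathstart_def pathfinish_def)
  ultimately have "?g \<circ> lambda_one \<doteq> ?g \<circ> lambda_inf"
    using induced_map_in_H_iff [of D_space lambda_one lambda_inf ?g] g d0 by (simp add: d_inf_def d0_def)
  then have "f \<circ> upsilon_inf \<doteq> f \<circ> lambda_inf"
  proof (rule coset_eq_cong)
    fix t :: real assume t: "t \<in> {0..1}"
    have "seg (\<Gamma> (gaps_within 0 1)) 0 1 t = seg (\<Gamma> UNIV) 0 1 t"
      by (rule seg_\<Gamma>_cong) (use t cantor_gapD in \<open>auto simp: gaps_within_def\<close>)
    then show "(?g \<circ> lambda_one) t = (f \<circ> upsilon_inf) t"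
      using D_to_W_D_path [of 1 1 t] t by (simp add: lambda_one_def dyadic_lo_def dyadic_hi_def upsilon_inf_eq)
    show "(?g \<circ> lambda_inf) t = (f \<circ> lambda_inf) t"
      by (simp add: lambda_inf_def D_to_W_line)
  qed
  then show ?thesis
    using w_inf_in_H_iff [OF f] by simp
qed

end

end

section \<open>Comparing the closure properties\<close>

theorem proposition7p6:
  fixes X :: "'a::topological_space set" and x0 :: 'a and H :: "(real \<Rightarrow> 'a) set set"
  assumes "path_connected X" and "x0 \<in> X"
    and "subgroup H (fundamental_group X x0)"
  shows "(closed_wrt D_space d0 D_subgroup d_inf X x0 H
            \<longrightarrow> closed_wrt W_space d0 W_subgroup w_inf X x0 H)
       \<and> (closed_wrt W_space d0 W_subgroup w_inf X x0 H
            \<longrightarrow> closed_wrt Hplus_space b0_plus C_subgroup c_tau X x0 H)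
       \<and> (H \<lhd> fundamental_group X x0 \<and> closed_wrt W_space d0 W_subgroup w_inf X x0 H
            \<longrightarrow> closed_wrt Hplus_space b0_plus P_subgroup p_tau X x0 H)"
proof -
  interpret pi1_subgroup X x0 H
    using assms(2,3) by (rule pi1_subgroup.intro)
  have "closed_wrt W_space d0 W_subgroup w_inf X x0 H"
    if "closed_wrt D_space d0 D_subgroup d_inf X x0 H"
    unfolding closed_wrt_def [of W_space] using w_inf_in_H [OF _ _ _ _ that] by blast
  moreover have "closed_wrt Hplus_space b0_plus C_subgroup c_tau X x0 H"
    if "closed_wrt W_space d0 W_subgroup w_inf X x0 H"
    unfolding closed_wrt_def [of Hplus_space] using c_tau_in_H [OF _ _ _ that] by blast
  moreover have "closed_wrt Hplus_space b0_plus P_subgroup p_tau X x0 H"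
    if "closed_wrt W_space d0 W_subgroup w_inf X x0 H" "H \<lhd> fundamental_group X x0"
    unfolding closed_wrt_def [of Hplus_space] using p_tau_in_H [OF _ _ _ that] by blast
  ultimately show ?thesis
    by blast
qed

end
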